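(* Let $\mathcal{C}$ be a right exact category. Then $\mathbf{Ac}(\mathcal{C})$ is a triangulated subcategory of $\mathbf{K}(\mathcal{C})$.
   Context: A right exact category is an additive category endowed with a distinguished class of kernels (morphisms that are kernels of some morphism), called inflations, such that: [R0] the identity morphism $1_0:0\to 0$ is an inflation; [R1] the composition of any two inflations is an inflation; [R2] the pushout of any inflation along an arbitrary morphism exists and is again an inflation. By [R2] (pushout along $A\to 0$), every inflation $i:A\to B$ has a cokernel $d:B\to C$; such a $d$ is called a deflation, and $A\xrightarrow{i}B\xrightarrow{d}C$ (which is a kernel-cokernel pair) is called a conflation. Complexes $A$ are $\mathbb{Z}$-indexed with differentials $d_A^n:A^n\to A^{n+1}$. $\mathbf{Ch}(\mathcal{C})$ is the additive category of complexes and chain maps over $\mathcal{C}$, and $\mathbf{K}(\mathcal{C})$ is the homotopy category, with the same objects and with homotopy classes of chain maps as morphisms; it is triangulated in the usual way via mapping cones, where the mapping cone of $f:A\to B$ has $n$-th component $A^{n+1}\oplus B^n$ and $n$-th differential $\left[\begin{smallmatrix}-d_A^{n+1}&0\\ f^{n+1}&d_B^n\end{smallmatrix}\right]$. A complex $A$ over a right exact category $\mathcal{C}$ is acyclic if each differential $d_A^{n-1}:A^{n-1}\to A^n$ factors as $d_A^{n-1}=i^{n-1}p^{n-1}$ with $p^{n-1}:A^{n-1}\to Z^nA$ a deflation that is a cokernel of $d_A^{n-2}$, and $i^{n-1}:Z^nA\to A^n$ an inflation that is a kernel of $d_A^n$. $\mathbf{Ac}(\mathcal{C})$ denotes the full subcategory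 of $\mathbf{K}(\mathcal{C})$ consisting of all acyclic complexes over $\mathcal{C}$. *)

theory Defs
  imports "HOL-Algebra.Group"
begin

section \<open>Additive categories\<close>

text \<open>
  Composition \<open>g \<cdot> f\<close> means \<open>g\<close> after \<open>f\<close>. The operations are total functions; they are only
  meaningful on composable (for \<open>\<boxplus>\<close>: parallel) arrows.
\<close>

record ('o, 'm) cat_data =
  obj :: "'o set"
  arr :: "'m set"
  src :: "'m \<Rightarrow> 'o"
  tgt :: "'m \<Rightarrow> 'o"
  idn :: "'o \<Rightarrow> 'm"
  cmp :: "'m \<Rightarrow> 'm \<Rightarrow> 'm"  (infixr \<open>\<cdot>\<index>\<close> 75)
  pls :: "'m \<Rightarrow> 'm \<Rightarrow> 'm"  (infixl \<open>\<boxplus>\<index>\<close> 65)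
  zer :: "'o \<Rightarrow> 'o \<Rightarrow> 'm"

definition Hom :: "('o, 'm, 'x) cat_data_scheme \<Rightarrow> 'o \<Rightarrow> 'o \<Rightarrow> 'm set" where
  "Hom C A B = {f \<in> arr C. src C f = A \<and> tgt C f = B}"

definition Hom_group :: "('o, 'm, 'x) cat_data_scheme \<Rightarrow> 'o \<Rightarrow> 'o \<Rightarrow> 'm monoid" where
  "Hom_group C A B = \<lparr>carrier = Hom C A B, mult = pls C, one = zer C A B\<rparr>"

definition neg :: "('o, 'm, 'x) cat_data_scheme \<Rightarrow> 'm \<Rightarrow> 'm" where
  "neg C f = inv\<^bsub>Hom_group C (src C f) (tgt C f)\<^esub> f"

locale category =
  fixes C :: "('o, 'm, 'x) cat_data_scheme" (structure)
  assumes src_obj: "f \<in> arr C \<Longrightarrow> src C f \<in> obj C"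
    and tgt_obj: "f \<in> arr C \<Longrightarrow> tgt C f \<in> obj C"
    and idn_Hom: "A \<in> obj C \<Longrightarrow> idn C A \<in> Hom C A A"
    and cmp_Hom: "\<lbrakk>f \<in> Hom C A B; g \<in> Hom C B D\<rbrakk> \<Longrightarrow> g \<cdot> f \<in> Hom C A D"
    and cmp_assoc: "\<lbrakk>f \<in> Hom C A B; g \<in> Hom C B D; h \<in> Hom C D E\<rbrakk>
          \<Longrightarrow> (h \<cdot> g) \<cdot> f = h \<cdot> (g \<cdot> f)"
    and cmp_idn_right: "f \<in> Hom C A B \<Longrightarrow> f \<cdot> idn C A = f"
    and cmp_idn_left: "f \<in> Hom C A B \<Longrightarrow> idn C B \<cdot> f = f"

locale preadditive_category = category +
  assumes Hom_comm_group: "\<lbrakk>A \<in> obj C; B \<in> obj C\<rbrakk> \<Longrightarrow> comm_group (Hom_group C A B)"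
    and cmp_pls_left: "\<lbrakk>f \<in> Hom C A B; g \<in> Hom C B D; g' \<in> Hom C B D\<rbrakk>
          \<Longrightarrow> (g \<boxplus> g') \<cdot> f = (g \<cdot> f) \<boxplus> (g' \<cdot> f)"
    and cmp_pls_right: "\<lbrakk>f \<in> Hom C A B; f' \<in> Hom C A B; g \<in> Hom C B D\<rbrakk>
          \<Longrightarrow> g \<cdot> (f \<boxplus> f') = (g \<cdot> f) \<boxplus> (g \<cdot> f')"

definition is_zero_object :: "('o, 'm, 'x) cat_data_scheme \<Rightarrow> 'o \<Rightarrow> bool" where
  "is_zero_object C Z \<longleftrightarrow> Z \<in> obj C \<and>
     (\<forall>X\<in>obj C. (\<exists>!f. f \<in> Hom C X Z) \<and> (\<exists>!f. f \<in> Hom C Z X))"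

definition is_biproduct ::
  "('o, 'm, 'x) cat_data_scheme \<Rightarrow> 'o \<Rightarrow> 'o \<Rightarrow> 'o \<times> 'm \<times> 'm \<times> 'm \<times> 'm \<Rightarrow> bool" where
  "is_biproduct C A B = (\<lambda>(P, i1, i2, p1, p2).
     i1 \<in> Hom C A P \<and> i2 \<in> Hom C B P \<and> p1 \<in> Hom C P A \<and> p2 \<in> Hom C P B \<and>
     p1 \<cdot>\<^bsub>C\<^esub> i1 = idn C A \<and> p2 \<cdot>\<^bsub>C\<^esub> i2 = idn C B \<and>
     p2 \<cdot>\<^bsub>C\<^esub> i1 = zer C A B \<and> p1 \<cdot>\<^bsub>C\<^esub> i2 = zer C B A \<and>
     (i1 \<cdot>\<^bsub>C\<^esub> p1) \<boxplus>\<^bsub>C\<^esub> (i2 \<cdot>\<^bsub>C\<^esub> p2) = idn C P)"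

locale additive_category = preadditive_category +
  assumes ex_zero_object: "\<exists>Z. is_zero_object C Z"
    and ex_biproduct: "\<lbrakk>A \<in> obj C; B \<in> obj C\<rbrakk> \<Longrightarrow> \<exists>P. is_biproduct C A B P"

definition isomorphism :: "('o, 'm, 'x) cat_data_scheme \<Rightarrow> 'm \<Rightarrow> bool" where
  "isomorphism C f \<longleftrightarrow> f \<in> arr C \<and>
     (\<exists>g \<in> Hom C (tgt C f) (src C f).
        g \<cdot>\<^bsub>C\<^esub> f = idn C (src C f) \<and> f \<cdot>\<^bsub>C\<^esub> g = idn C (tgt C f))"

definition isomorphic :: "('o, 'm, 'x) cat_data_scheme \<Rightarrow> 'o \<Rightarrow> 'o \<Rightarrow> bool" where
  "isomorphic C A B \<longleftrightarrow> (\<exists>f \<in> Hom C A B. isomorphism C f)"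

definition full_subcategory ::
  "('o, 'm, 'x) cat_data_scheme \<Rightarrow> 'o set \<Rightarrow> ('o, 'm, 'x) cat_data_scheme" where
  "full_subcategory C S =
     C\<lparr>obj := S, arr := {f \<in> arr C. src C f \<in> S \<and> tgt C f \<in> S}\<rparr>"


section \<open>Right exact categories\<close>

definition is_kernel :: "('o, 'm, 'x) cat_data_scheme \<Rightarrow> 'm \<Rightarrow> 'm \<Rightarrow> bool" where
  "is_kernel C k f \<longleftrightarrow>
     k \<in> arr C \<and> f \<in> arr C \<and> tgt C k = src C f \<and> f \<cdot>\<^bsub>C\<^esub> k = zer C (src C k) (tgt C f) \<and>
     (\<forall>X\<in>obj C. \<forall>t \<in> Hom C X (src C f). f \<cdot>\<^bsub>C\<^esub> t = zer C X (tgt C f) \<longrightarrow>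
        (\<exists>!s. s \<in> Hom C X (src C k) \<and> k \<cdot>\<^bsub>C\<^esub> s = t))"

definition is_cokernel :: "('o, 'm, 'x) cat_data_scheme \<Rightarrow> 'm \<Rightarrow> 'm \<Rightarrow> bool" where
  "is_cokernel C c f \<longleftrightarrow>
     c \<in> arr C \<and> f \<in> arr C \<and> src C c = tgt C f \<and> c \<cdot>\<^bsub>C\<^esub> f = zer C (src C f) (tgt C c) \<and>
     (\<forall>X\<in>obj C. \<forall>t \<in> Hom C (tgt C f) X. t \<cdot>\<^bsub>C\<^esub> f = zer C (src C f) X \<longrightarrow>
        (\<exists>!s. s \<in> Hom C (tgt C c) X \<and> s \<cdot>\<^bsub>C\<^esub> c = t))"

text \<open>
  The square \<open>i' \<cdot> f = f' \<cdot> i\<close> is a pushout of \<open>i : A \<rightarrow> B\<close> and \<open>f : A \<rightarrow> A'\<close>; here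
  \<open>i' : A' \<rightarrow> P\<close> is the pushout of \<open>i\<close> along \<open>f\<close>.
\<close>

definition is_pushout :: "('o, 'm, 'x) cat_data_scheme \<Rightarrow> 'm \<Rightarrow> 'm \<Rightarrow> 'm \<Rightarrow> 'm \<Rightarrow> bool" where
  "is_pushout C i f i' f' \<longleftrightarrow>
     i \<in> arr C \<and> f \<in> arr C \<and> i' \<in> arr C \<and> f' \<in> arr C \<and>
     src C i = src C f \<and> src C i' = tgt C f \<and> src C f' = tgt C i \<and> tgt C i' = tgt C f' \<and>
     i' \<cdot>\<^bsub>C\<^esub> f = f' \<cdot>\<^bsub>C\<^esub> i \<and>
     (\<forall>X\<in>obj C. \<forall>u \<in> Hom C (tgt C f) X. \<forall>v \<in> Hom C (tgt C i) X.
        u \<cdot>\<^bsub>C\<^esub> f = v \<cdot>\<^bsub>C\<^esub> i \<longrightarrow>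
        (\<exists>!s. s \<in> Hom C (tgt C i') X \<and> s \<cdot>\<^bsub>C\<^esub> i' = u \<and> s \<cdot>\<^bsub>C\<^esub> f' = v))"

text \<open>
  \<open>\<I>\<close> is the class of inflations. Zero objects and pushouts are determined only up to
  isomorphism, so R0 speaks about every zero object and R2 about every pushout; in
  particular \<open>\<I>\<close> is closed under isomorphisms.
\<close>

locale right_exact_category = additive_category C
  for C :: "('o, 'm, 'x) cat_data_scheme" (structure) +
  fixes \<I> :: "'m set"
  assumes inflation_arr: "\<I> \<subseteq> arr C"
    and inflation_kernel: "i \<in> \<I> \<Longrightarrow> \<exists>f. is_kernel C i f"
    and R0: "is_zero_object C Z \<Longrightarrow> idn C Z \<in> \<I>"
    and R1: "\<lbrakk>i \<in> \<I>; j \<in> \<I>; tgt C i = src C j\<rbrakk> \<Longrightarrow> j \<cdot> i \<in> \<I>"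
    and R2_ex: "\<lbrakk>i \<in> \<I>; f \<in> arr C; src C f = src C i\<rbrakk> \<Longrightarrow> \<exists>i' f'. is_pushout C i f i' f'"
    and R2_inflation: "\<lbrakk>i \<in> \<I>; is_pushout C i f i' f'\<rbrakk> \<Longrightarrow> i' \<in> \<I>"

definition deflations :: "('o, 'm, 'x) cat_data_scheme \<Rightarrow> 'm set \<Rightarrow> 'm set" where
  "deflations C \<I> = {d. \<exists>i\<in>\<I>. is_cokernel C d i}"


section \<open>Complexes and chain maps\<close>

datatype ('o, 'm) cochain = Cochain (cob: "int \<Rightarrow> 'o") (dif: "int \<Rightarrow> 'm")

definition is_complex :: "('o, 'm, 'x) cat_data_scheme \<Rightarrow> ('o, 'm) cochain \<Rightarrow> bool" where
  "is_complex C A \<longleftrightarrow>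
     (\<forall>n. cob A n \<in> obj C \<and> dif A n \<in> Hom C (cob A n) (cob A (n + 1)) \<and>
          dif A (n + 1) \<cdot>\<^bsub>C\<^esub> dif A n = zer C (cob A n) (cob A (n + 2)))"

datatype ('o, 'm) chmap =
  Chmap (cm_src: "('o, 'm) cochain") (cm_tgt: "('o, 'm) cochain") (cm: "int \<Rightarrow> 'm")

definition is_chain_map :: "('o, 'm, 'x) cat_data_scheme \<Rightarrow> ('o, 'm) chmap \<Rightarrow> bool" where
  "is_chain_map C f \<longleftrightarrow> is_complex C (cm_src f) \<and> is_complex C (cm_tgt f) \<and>
     (\<forall>n. cm f n \<in> Hom C (cob (cm_src f) n) (cob (cm_tgt f) n) \<and>
          dif (cm_tgt f) n \<cdot>\<^bsub>C\<^esub> cm f n = cm f (n + 1) \<cdot>\<^bsub>C\<^esub> dif (cm_src f) n)"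

definition Ch ::
  "('o, 'm, 'x) cat_data_scheme \<Rightarrow> (('o, 'm) cochain, ('o, 'm) chmap) cat_data" where
  "Ch C =
     \<lparr>obj = {A. is_complex C A},
      arr = {f. is_chain_map C f},
      src = cm_src,
      tgt = cm_tgt,
      idn = (\<lambda>A. Chmap A A (\<lambda>n. idn C (cob A n))),
      cmp = (\<lambda>g f. Chmap (cm_src f) (cm_tgt g) (\<lambda>n. cm g n \<cdot>\<^bsub>C\<^esub> cm f n)),
      pls = (\<lambda>f g. Chmap (cm_src f) (cm_tgt f) (\<lambda>n. cm f n \<boxplus>\<^bsub>C\<^esub> cm g n)),
      zer = (\<lambda>A B. Chmap A B (\<lambda>n. zer C (cob A n) (cob B n)))\<rparr>"


section \<open>The homotopy category\<close>

definition homotopic ::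
  "('o, 'm, 'x) cat_data_scheme \<Rightarrow> ('o, 'm) chmap \<Rightarrow> ('o, 'm) chmap \<Rightarrow> bool" where
  "homotopic C f g \<longleftrightarrow> is_chain_map C f \<and> is_chain_map C g \<and>
     cm_src f = cm_src g \<and> cm_tgt f = cm_tgt g \<and>
     (\<exists>h. \<forall>n. h n \<in> Hom C (cob (cm_src f) n) (cob (cm_tgt f) (n - 1)) \<and>
        cm f n \<boxplus>\<^bsub>C\<^esub> neg C (cm g n) =
          (dif (cm_tgt f) (n - 1) \<cdot>\<^bsub>C\<^esub> h n) \<boxplus>\<^bsub>C\<^esub> (h (n + 1) \<cdot>\<^bsub>C\<^esub> dif (cm_src f) n))"

definition htpy_class ::
  "('o, 'm, 'x) cat_data_scheme \<Rightarrow> ('o, 'm) chmap \<Rightarrow> ('o, 'm) chmap set" where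
  "htpy_class C f = {g. homotopic C f g}"

definition rep :: "'a set \<Rightarrow> 'a" where
  "rep F = (SOME f. f \<in> F)"

definition K ::
  "('o, 'm, 'x) cat_data_scheme \<Rightarrow> (('o, 'm) cochain, ('o, 'm) chmap set) cat_data" where
  "K C =
     \<lparr>obj = obj (Ch C),
      arr = htpy_class C ` arr (Ch C),
      src = (\<lambda>F. cm_src (rep F)),
      tgt = (\<lambda>F. cm_tgt (rep F)),
      idn = (\<lambda>A. htpy_class C (idn (Ch C) A)),
      cmp = (\<lambda>G F. htpy_class C (rep G \<cdot>\<^bsub>Ch C\<^esub> rep F)),
      pls = (\<lambda>F G. htpy_class C (rep F \<boxplus>\<^bsub>Ch C\<^esub> rep G)),
      zer = (\<lambda>A B. htpy_class C (zer (Ch C) A B))\<rparr>"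


section \<open>Shift, mapping cones and distinguished triangles\<close>

definition shift :: "('o, 'm, 'x) cat_data_scheme \<Rightarrow> ('o, 'm) cochain \<Rightarrow> ('o, 'm) cochain" where
  "shift C A = Cochain (\<lambda>n. cob A (n + 1)) (\<lambda>n. neg C (dif A (n + 1)))"

definition shift_map :: "('o, 'm, 'x) cat_data_scheme \<Rightarrow> ('o, 'm) chmap \<Rightarrow> ('o, 'm) chmap" where
  "shift_map C f = Chmap (shift C (cm_src f)) (shift C (cm_tgt f)) (\<lambda>n. cm f (n + 1))"

definition K_shift ::
  "('o, 'm, 'x) cat_data_scheme \<Rightarrow> ('o, 'm) chmap set \<Rightarrow> ('o, 'm) chmap set" where
  "K_shift C F = htpy_class C (shift_map C (rep F))"

text \<open>
  A fixed choice of biproducts. Another choice changes mapping cones only up to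
  isomorphism and hence does not affect the class of distinguished triangles.
\<close>

definition biprod ::
  "('o, 'm, 'x) cat_data_scheme \<Rightarrow> 'o \<Rightarrow> 'o \<Rightarrow> 'o \<times> 'm \<times> 'm \<times> 'm \<times> 'm" where
  "biprod C A B = (SOME P. is_biproduct C A B P)"

definition bsum :: "('o, 'm, 'x) cat_data_scheme \<Rightarrow> 'o \<Rightarrow> 'o \<Rightarrow> 'o" where
  "bsum C A B = (case biprod C A B of (P, i1, i2, p1, p2) \<Rightarrow> P)"

definition in1 :: "('o, 'm, 'x) cat_data_scheme \<Rightarrow> 'o \<Rightarrow> 'o \<Rightarrow> 'm" where
  "in1 C A B = (case biprod C A B of (P, i1, i2, p1, p2) \<Rightarrow> i1)"

definition in2 :: "('o, 'm, 'x) cat_data_scheme \<Rightarrow> 'o \<Rightarrow> 'o \<Rightarrow> 'm" where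
  "in2 C A B = (case biprod C A B of (P, i1, i2, p1, p2) \<Rightarrow> i2)"

definition pr1 :: "('o, 'm, 'x) cat_data_scheme \<Rightarrow> 'o \<Rightarrow> 'o \<Rightarrow> 'm" where
  "pr1 C A B = (case biprod C A B of (P, i1, i2, p1, p2) \<Rightarrow> p1)"

definition pr2 :: "('o, 'm, 'x) cat_data_scheme \<Rightarrow> 'o \<Rightarrow> 'o \<Rightarrow> 'm" where
  "pr2 C A B = (case biprod C A B of (P, i1, i2, p1, p2) \<Rightarrow> p2)"

text \<open>
  \<open>mat22 C A B A' B' a b c d\<close> is the morphism \<open>A \<oplus> B \<rightarrow> A' \<oplus> B'\<close> with matrix rows
  \<open>(a, b)\<close> and \<open>(c, d)\<close>, acting on columns.
\<close>

definition mat22 ::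
  "('o, 'm, 'x) cat_data_scheme \<Rightarrow> 'o \<Rightarrow> 'o \<Rightarrow> 'o \<Rightarrow> 'o \<Rightarrow> 'm \<Rightarrow> 'm \<Rightarrow> 'm \<Rightarrow> 'm \<Rightarrow> 'm" where
  "mat22 C A B A' B' a b c d =
     (in1 C A' B' \<cdot>\<^bsub>C\<^esub> ((a \<cdot>\<^bsub>C\<^esub> pr1 C A B) \<boxplus>\<^bsub>C\<^esub> (b \<cdot>\<^bsub>C\<^esub> pr2 C A B))) \<boxplus>\<^bsub>C\<^esub>
     (in2 C A' B' \<cdot>\<^bsub>C\<^esub> ((c \<cdot>\<^bsub>C\<^esub> pr1 C A B) \<boxplus>\<^bsub>C\<^esub> (d \<cdot>\<^bsub>C\<^esub> pr2 C A B)))"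

definition cone :: "('o, 'm, 'x) cat_data_scheme \<Rightarrow> ('o, 'm) chmap \<Rightarrow> ('o, 'm) cochain" where
  "cone C f = (let A = cm_src f; B = cm_tgt f in
     Cochain
       (\<lambda>n. bsum C (cob A (n + 1)) (cob B n))
       (\<lambda>n. mat22 C (cob A (n + 1)) (cob B n) (cob A (n + 2)) (cob B (n + 1))
              (neg C (dif A (n + 1))) (zer C (cob B n) (cob A (n + 2)))
              (cm f (n + 1))          (dif B n)))"

definition cone_in :: "('o, 'm, 'x) cat_data_scheme \<Rightarrow> ('o, 'm) chmap \<Rightarrow> ('o, 'm) chmap" where
  "cone_in C f = Chmap (cm_tgt f) (cone C f)
     (\<lambda>n. in2 C (cob (cm_src f) (n + 1)) (cob (cm_tgt f) n))"

definition cone_pr :: "('o, 'm, 'x) cat_data_scheme \<Rightarrow> ('o, 'm) chmap \<Rightarrow> ('o, 'm) chmap" where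
  "cone_pr C f = Chmap (cone C f) (shift C (cm_src f))
     (\<lambda>n. pr1 C (cob (cm_src f) (n + 1)) (cob (cm_tgt f) n))"

text \<open>
  A triangle \<open>X \<rightarrow> Y \<rightarrow> Z \<rightarrow> X[1]\<close> in the homotopy category is distinguished if it is
  isomorphic to the triangle \<open>A \<rightarrow> B \<rightarrow> cone f \<rightarrow> A[1]\<close> of some chain map \<open>f : A \<rightarrow> B\<close>.
\<close>

definition distinguished_triangles ::
  "('o, 'm, 'x) cat_data_scheme \<Rightarrow>
   (('o, 'm) chmap set \<times> ('o, 'm) chmap set \<times> ('o, 'm) chmap set) set" where
  "distinguished_triangles C = {(u, v, w).
     u \<in> arr (K C) \<and> v \<in> arr (K C) \<and> w \<in> arr (K C) \<and>
     tgt (K C) u = src (K C) v \<and> tgt (K C) v = src (K C) w \<and>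
     tgt (K C) w = shift C (src (K C) u) \<and>
     (\<exists>f \<in> arr (Ch C).
      \<exists>a \<in> Hom (K C) (src (K C) u) (cm_src f).
      \<exists>b \<in> Hom (K C) (src (K C) v) (cm_tgt f).
      \<exists>c \<in> Hom (K C) (src (K C) w) (cone C f).
        isomorphism (K C) a \<and> isomorphism (K C) b \<and> isomorphism (K C) c \<and>
        b \<cdot>\<^bsub>K C\<^esub> u = htpy_class C f \<cdot>\<^bsub>K C\<^esub> a \<and>
        c \<cdot>\<^bsub>K C\<^esub> v = htpy_class C (cone_in C f) \<cdot>\<^bsub>K C\<^esub> b \<and>
        K_shift C a \<cdot>\<^bsub>K C\<^esub> w = htpy_class C (cone_pr C f) \<cdot>\<^bsub>K C\<^esub> c)}"

text \<open>
  Let \<open>T\<close> be a triangulated category whose shift acts as \<open>\<Sigma>\<close> on objects and whose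
  distinguished triangles are \<open>\<Delta>\<close>. The full subcategory on the objects \<open>S\<close> is a triangulated
  subcategory if it is additive, satisfies \<open>\<Sigma> S = S\<close>, and the third vertex of every
  distinguished triangle whose first two vertices lie in \<open>S\<close> is isomorphic to an object of \<open>S\<close>.
  The subcategory is not required to be closed under isomorphisms in \<open>T\<close>: acyclic complexes
  over a category that is not idempotent complete need not be.
\<close>

definition triangulated_subcategory ::
  "('o, 'm, 'x) cat_data_scheme \<Rightarrow> ('o \<Rightarrow> 'o) \<Rightarrow> ('m \<times> 'm \<times> 'm) set \<Rightarrow> 'o set \<Rightarrow> bool" where
  "triangulated_subcategory T \<Sigma> \<Delta> S \<longleftrightarrow>
     S \<subseteq> obj T \<and>
     additive_category (full_subcategory T S) \<and>
     \<Sigma> ` S = S \<and>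
     (\<forall>(u, v, w) \<in> \<Delta>. src T u \<in> S \<and> src T v \<in> S \<longrightarrow> (\<exists>Z\<in>S. isomorphic T (src T w) Z))"


section \<open>Acyclic complexes\<close>

definition acyclic :: "('o, 'm, 'x) cat_data_scheme \<Rightarrow> 'm set \<Rightarrow> ('o, 'm) cochain \<Rightarrow> bool" where
  "acyclic C \<I> A \<longleftrightarrow> is_complex C A \<and>
     (\<forall>n. \<exists>p i. p \<in> deflations C \<I> \<and> is_cokernel C p (dif A (n - 2)) \<and>
                i \<in> \<I> \<and> is_kernel C i (dif A n) \<and>
                tgt C p = src C i \<and> dif A (n - 1) = i \<cdot>\<^bsub>C\<^esub> p)"

definition Ac :: "('o, 'm, 'x) cat_data_scheme \<Rightarrow> 'm set \<Rightarrow> ('o, 'm) cochain set" where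
  "Ac C \<I> = {A. acyclic C \<I> A}"

end

theory Submission
  imports Defs
begin

text \<open>
  Let \<open>f : A \<rightarrow> B\<close> be a chain map of acyclic complexes, with cocycle inflations
  \<open>i n : Z\<^sup>nA \<rightarrow> A\<^sup>n\<close> and \<open>j n : Z\<^sup>nB \<rightarrow> B\<^sup>n\<close> and induced arrows \<open>g n : Z\<^sup>nA \<rightarrow> Z\<^sup>nB\<close>. The cocycles of
  the cone of \<open>f\<close> are the pushouts \<open>P n\<close> of \<open>i n\<close> along \<open>g n\<close>. There are arrows
  \<open>q : P n \<rightarrow> Z\<^sup>n\<^sup>+\<^sup>1A\<close> and \<open>r : P n \<rightarrow> B\<^sup>n\<close>, and \<open>(-q, r)\<close> is an inflation because it is the pushout of
  \<open>j n\<close> along \<open>Z\<^sup>nB \<rightarrow> P n\<close>; this avoids split monomorphisms such as \<open>(1, f)\<close>, which need not be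
  inflations since \<open>0 \<rightarrow> X\<close> need not be one. Composing it with \<open>i (n + 1) \<oplus> 1\<close>, a pushout of \<open>i (n + 1)\<close>,
  gives the inflation \<open>P n \<rightarrow> A\<^sup>n\<^sup>+\<^sup>1 \<oplus> B\<^sup>n\<close>, whose cokernel is \<open>P (n + 1)\<close>.

  An arbitrary distinguished triangle is reduced to this case by comparing cones: the cones of
  two chain maps that are isomorphic in the homotopy category are homotopy equivalent, because
  the obvious comparison maps compose to maps homotopic to unipotent triangular matrices.
\<close>

section \<open>Calculus in preadditive categories\<close>

lemma Hom_iff: "f \<in> Hom C A B \<longleftrightarrow> f \<in> arr C \<and> src C f = A \<and> tgt C f = B"
  by (auto simp: Hom_def)

section \<open>Composition and isomorphisms in a category\<close>

context category
begin

lemma Hom_obj: "f \<in> Hom C A B \<Longrightarrow> A \<in> obj C \<and> B \<in> obj C"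
  using src_obj tgt_obj by (auto simp: Hom_iff)

lemma src_tgt_obj [simp]:
  "f \<in> arr C \<Longrightarrow> src C f \<in> obj C" "f \<in> arr C \<Longrightarrow> tgt C f \<in> obj C"
  by (simp_all add: src_obj tgt_obj)

lemma idn_arr [simp]:
  assumes "A \<in> obj C"
  shows "idn C A \<in> arr C" "src C (idn C A) = A" "tgt C (idn C A) = A"
  using idn_Hom[OF assms] by (auto simp: Hom_iff)

lemma cmp_arr [simp]:
  assumes "f \<in> arr C" "g \<in> arr C" "src C g = tgt C f"
  shows "g \<cdot> f \<in> arr C" "src C (g \<cdot> f) = src C f" "tgt C (g \<cdot> f) = tgt C g"
  using cmp_Hom[of f "src C f" "tgt C f" g "tgt C g"] assms by (auto simp: Hom_iff)

lemma cmp_assoc' [simp]: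
  assumes "f \<in> arr C" "g \<in> arr C" "h \<in> arr C" "src C g = tgt C f" "src C h = tgt C g"
  shows "(h \<cdot> g) \<cdot> f = h \<cdot> (g \<cdot> f)"
  using assms by (intro cmp_assoc) (auto simp: Hom_iff)

lemma cmp_idn [simp]:
  "f \<in> arr C \<Longrightarrow> src C f = A \<Longrightarrow> f \<cdot> idn C A = f"
  "f \<in> arr C \<Longrightarrow> tgt C f = B \<Longrightarrow> idn C B \<cdot> f = f"
  using cmp_idn_left[of f "src C f" "tgt C f"] cmp_idn_right[of f "src C f" "tgt C f"]
  by (auto simp: Hom_iff)

lemma isomorphismI:
  assumes "f \<in> Hom C A B" "g \<in> Hom C B A" "g \<cdot> f = idn C A" "f \<cdot> g = idn C B"
  shows "isomorphism C f"
  using assms by (auto simp: isomorphism_def Hom_iff)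

lemma isomorphismE:
  assumes "isomorphism C f" "f \<in> Hom C A B"
  obtains g where "g \<in> Hom C B A" "g \<cdot> f = idn C A" "f \<cdot> g = idn C B"
  using assms by (auto simp: isomorphism_def Hom_iff)

lemma isomorphic_sym: "isomorphic C A B \<Longrightarrow> isomorphic C B A"
  unfolding isomorphic_def by (metis isomorphismE isomorphismI)

lemma isomorphic_trans:
  assumes "isomorphic C A B" "isomorphic C B D"
  shows "isomorphic C A D"
proof -
  obtain f f' where f: "f \<in> Hom C A B" "f' \<in> Hom C B A" "f' \<cdot> f = idn C A" "f \<cdot> f' = idn C B"
    using assms(1) unfolding isomorphic_def by (metis isomorphismE)
  obtain g g' where g: "g \<in> Hom C B D" "g' \<in> Hom C D B" "g' \<cdot> g = idn C B" "g \<cdot> g' = idn C D"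
    using assms(2) unfolding isomorphic_def by (metis isomorphismE)
  have "(f' \<cdot> g') \<cdot> (g \<cdot> f) = f' \<cdot> ((g' \<cdot> g) \<cdot> f)" "(g \<cdot> f) \<cdot> (f' \<cdot> g') = g \<cdot> ((f \<cdot> f') \<cdot> g')"
    using f(1,2) g(1,2) by (auto simp: Hom_iff)
  hence "isomorphism C (g \<cdot> f)"
    using f g by (intro isomorphismI[of _ A D "f' \<cdot> g'"]) (auto simp: Hom_iff)
  moreover have "g \<cdot> f \<in> Hom C A D" using f g by (auto simp: Hom_iff)
  ultimately show ?thesis unfolding isomorphic_def by blast
qed

text \<open>If \<open>x\<close> inverts \<open>g \<cdot> f\<close> on the left and \<open>y\<close>
  inverts \<open>f \<cdot> g\<close> on the right, then \<open>x \<cdot> g\<close> and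
  \<open>g \<cdot> y\<close> are a left and a right inverse of \<open>f\<close>, hence equal. This
  lets cones be compared through two maps that need not be inverse to each other.\<close>

lemma isomorphism_if_both_composites:
  assumes f: "f \<in> Hom C A B" and g: "g \<in> Hom C B A"
    and gf: "isomorphism C (g \<cdot> f)" and fg: "isomorphism C (f \<cdot> g)"
  shows "isomorphism C f"
proof -
  have "g \<cdot> f \<in> Hom C A A" "f \<cdot> g \<in> Hom C B B" using f g by (auto simp: Hom_iff)
  then obtain x y where x: "x \<in> Hom C A A" "x \<cdot> (g \<cdot> f) = idn C A"
    and y: "y \<in> Hom C B B" "(f \<cdot> g) \<cdot> y = idn C B"
    using gf fg by (metis isomorphismE)
  have "x \<cdot> g = (x \<cdot> g) \<cdot> ((f \<cdot> g) \<cdot> y)"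
    unfolding y(2) using f g x(1) by (auto simp: Hom_iff)
  also have "\<dots> = (x \<cdot> (g \<cdot> f)) \<cdot> (g \<cdot> y)" using f g x(1) y(1) by (auto simp: Hom_iff)
  also have "\<dots> = g \<cdot> y" unfolding x(2) using f g y(1) by (auto simp: Hom_iff)
  finally have xg: "x \<cdot> g = g \<cdot> y" .
  show ?thesis
  proof (rule isomorphismI[OF f, of "x \<cdot> g"])
    show "x \<cdot> g \<in> Hom C B A" using g x(1) by (auto simp: Hom_iff)
    show "(x \<cdot> g) \<cdot> f = idn C A" using f g x by (auto simp: Hom_iff)
    show "f \<cdot> (x \<cdot> g) = idn C B" unfolding xg using f g y by (auto simp: Hom_iff)
  qed
qed

end

section \<open>Arithmetic of parallel arrows: sums, negatives and zeros\<close>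

context preadditive_category
begin

lemma Hom_group_simps:
  "carrier (Hom_group C A B) = Hom C A B" "mult (Hom_group C A B) = pls C"
  "one (Hom_group C A B) = zer C A B"
  by (simp_all add: Hom_group_def)

lemma zer_arr [simp]:
  assumes "A \<in> obj C" "B \<in> obj C"
  shows "zer C A B \<in> arr C" "src C (zer C A B) = A" "tgt C (zer C A B) = B"
proof -
  interpret G: comm_group "Hom_group C A B" using assms by (rule Hom_comm_group)
  show "zer C A B \<in> arr C" "src C (zer C A B) = A" "tgt C (zer C A B) = B"
    using G.one_closed by (auto simp: Hom_group_simps Hom_iff)
qed

lemma neg_arr [simp]:
  assumes "f \<in> arr C"
  shows "neg C f \<in> arr C" "src C (neg C f) = src C f" "tgt C (neg C f) = tgt C f"
proof -
  interpret G: comm_group "Hom_group C (src C f) (tgt C f)"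
    using assms by (simp add: Hom_comm_group)
  show "neg C f \<in> arr C" "src C (neg C f) = src C f" "tgt C (neg C f) = tgt C f"
    using G.inv_closed[of f] assms unfolding neg_def by (auto simp: Hom_group_simps Hom_iff)
qed

lemma pls_arr [simp]:
  assumes "f \<in> arr C" "g \<in> arr C" "src C f = src C g" "tgt C f = tgt C g"
  shows "f \<boxplus> g \<in> arr C" "src C (f \<boxplus> g) = src C g" "tgt C (f \<boxplus> g) = tgt C g"
proof -
  interpret G: comm_group "Hom_group C (src C g) (tgt C g)"
    using assms by (simp add: Hom_comm_group)
  show "f \<boxplus> g \<in> arr C" "src C (f \<boxplus> g) = src C g" "tgt C (f \<boxplus> g) = tgt C g"
    using G.m_closed[of f g] assms by (auto simp: Hom_group_simps Hom_iff)
qed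

lemma pls_neg [simp]:
  assumes "f \<in> arr C"
  shows "f \<boxplus> neg C f = zer C (src C f) (tgt C f)" "neg C f \<boxplus> f = zer C (src C f) (tgt C f)"
proof -
  interpret G: comm_group "Hom_group C (src C f) (tgt C f)"
    using assms by (simp add: Hom_comm_group)
  show "f \<boxplus> neg C f = zer C (src C f) (tgt C f)" "neg C f \<boxplus> f = zer C (src C f) (tgt C f)"
    using G.r_inv[of f] G.l_inv[of f] assms
    unfolding neg_def by (auto simp: Hom_group_simps Hom_iff)
qed

lemma pls_zer [simp]:
  assumes "f \<in> arr C" "src C f = A" "tgt C f = B"
  shows "f \<boxplus> zer C A B = f" "zer C A B \<boxplus> f = f"
proof -
  interpret G: comm_group "Hom_group C A B"
    using assms by (auto simp: Hom_comm_group)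
  show "f \<boxplus> zer C A B = f" "zer C A B \<boxplus> f = f"
    using G.r_one[of f] G.l_one[of f] assms by (auto simp: Hom_group_simps Hom_iff)
qed

lemma pls_comm:
  assumes "f \<in> arr C" "g \<in> arr C" "src C f = src C g" "tgt C f = tgt C g"
  shows "f \<boxplus> g = g \<boxplus> f"
proof -
  interpret G: comm_group "Hom_group C (src C g) (tgt C g)"
    using assms by (simp add: Hom_comm_group)
  show ?thesis using G.m_comm[of f g] assms by (auto simp: Hom_group_simps Hom_iff)
qed

lemma pls_assoc:
  assumes "f \<in> arr C" "g \<in> arr C" "h \<in> arr C" "src C f = src C g" "tgt C f = tgt C g"
    "src C g = src C h" "tgt C g = tgt C h"
  shows "f \<boxplus> g \<boxplus> h = f \<boxplus> (g \<boxplus> h)"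
proof -
  interpret G: comm_group "Hom_group C (src C h) (tgt C h)"
    using assms by (simp add: Hom_comm_group)
  show ?thesis using G.m_assoc[of f g h] assms by (auto simp: Hom_group_simps Hom_iff)
qed

lemma pls_left_comm:
  assumes "f \<in> arr C" "g \<in> arr C" "h \<in> arr C" "src C f = src C g" "tgt C f = tgt C g"
    "src C g = src C h" "tgt C g = tgt C h"
  shows "f \<boxplus> (g \<boxplus> h) = g \<boxplus> (f \<boxplus> h)"
proof -
  have "f \<boxplus> (g \<boxplus> h) = f \<boxplus> g \<boxplus> h" by (rule pls_assoc[symmetric]) fact+
  also have "f \<boxplus> g = g \<boxplus> f" by (rule pls_comm) fact+
  also have "g \<boxplus> f \<boxplus> h = g \<boxplus> (f \<boxplus> h)" using assms by (intro pls_assoc) simp_all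
  finally show ?thesis .
qed

lemma pls_cancel_left:
  assumes "f \<in> arr C" "g \<in> arr C" "h \<in> arr C" "src C f = src C g" "tgt C f = tgt C g"
    "src C g = src C h" "tgt C g = tgt C h"
  shows "f \<boxplus> g = f \<boxplus> h \<longleftrightarrow> g = h"
proof -
  interpret G: comm_group "Hom_group C (src C h) (tgt C h)"
    using assms by (simp add: Hom_comm_group)
  show ?thesis using G.Units_l_cancel[of f g h] assms by (auto simp: Hom_group_simps Hom_iff)
qed

lemma neg_pls_cancel [simp]:
  assumes "f \<in> arr C" "g \<in> arr C" "src C f = src C g" "tgt C f = tgt C g"
  shows "f \<boxplus> (neg C f \<boxplus> g) = g" "neg C f \<boxplus> (f \<boxplus> g) = g"
  using assms pls_assoc[of f "neg C f" g] pls_assoc[of "neg C f" f g] by simp_all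

lemma neg_unique:
  assumes "f \<in> arr C" "g \<in> arr C" "src C f = src C g" "tgt C f = tgt C g"
    "f \<boxplus> g = zer C (src C f) (tgt C f)"
  shows "g = neg C f"
proof -
  have "f \<boxplus> g = f \<boxplus> neg C f" using assms(1,5) by simp
  thus ?thesis using assms(1-4) by (subst (asm) pls_cancel_left) simp_all
qed

lemma eq_if_diff_zer:
  assumes "f \<in> arr C" "g \<in> arr C" "src C f = src C g" "tgt C f = tgt C g"
    "f \<boxplus> neg C g = zer C (src C f) (tgt C f)"
  shows "f = g"
proof -
  have "neg C g \<boxplus> f = neg C g \<boxplus> g"
    using assms pls_comm[of "neg C g" f] by simp
  thus ?thesis using assms by (subst (asm) pls_cancel_left) simp_all
qed

lemma neg_neg [simp]: "f \<in> arr C \<Longrightarrow> neg C (neg C f) = f"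
  using neg_unique[of "neg C f" f] by simp

lemma neg_zer [simp]: "A \<in> obj C \<Longrightarrow> B \<in> obj C \<Longrightarrow> neg C (zer C A B) = zer C A B"
  using neg_unique[of "zer C A B" "zer C A B"] by simp

lemma neg_pls:
  assumes "f \<in> arr C" "g \<in> arr C" "src C f = src C g" "tgt C f = tgt C g"
  shows "neg C (f \<boxplus> g) = neg C f \<boxplus> neg C g"
proof -
  have "f \<boxplus> g \<boxplus> (neg C f \<boxplus> neg C g) = f \<boxplus> (neg C f \<boxplus> (g \<boxplus> neg C g))"
    using assms by (simp add: pls_assoc pls_left_comm[of g "neg C f" "neg C g"])
  thus ?thesis using assms by (intro neg_unique[symmetric]) simp_all
qed

lemma pls_cmp:
  assumes "f \<in> arr C" "g \<in> arr C" "g' \<in> arr C" "src C g = src C g'" "tgt C g = tgt C g'"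
    "src C g' = tgt C f"
  shows "(g \<boxplus> g') \<cdot> f = (g \<cdot> f) \<boxplus> (g' \<cdot> f)"
  using assms by (intro cmp_pls_left) (auto simp: Hom_iff)

lemma cmp_pls:
  assumes "f \<in> arr C" "f' \<in> arr C" "g \<in> arr C" "src C f = src C f'" "tgt C f = tgt C f'"
    "src C g = tgt C f'"
  shows "g \<cdot> (f \<boxplus> f') = (g \<cdot> f) \<boxplus> (g \<cdot> f')"
  using assms by (intro cmp_pls_right) (auto simp: Hom_iff)

lemma cmp_zer [simp]:
  assumes "g \<in> arr C" "A \<in> obj C" "src C g = B"
  shows "g \<cdot> zer C A B = zer C A (tgt C g)"
proof -
  let ?z = "zer C A B"
  have B: "B \<in> obj C" using assms by auto
  have "g \<cdot> ?z \<boxplus> g \<cdot> ?z = g \<cdot> (?z \<boxplus> ?z)" using assms B by (subst cmp_pls) auto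
  also have "\<dots> = g \<cdot> ?z \<boxplus> zer C A (tgt C g)" using assms B by simp
  finally show ?thesis using assms B by (subst (asm) pls_cancel_left) simp_all
qed

lemma zer_cmp [simp]:
  assumes "f \<in> arr C" "B \<in> obj C" "tgt C f = A"
  shows "zer C A B \<cdot> f = zer C (src C f) B"
proof -
  let ?z = "zer C A B"
  have A: "A \<in> obj C" using assms by auto
  have "?z \<cdot> f \<boxplus> ?z \<cdot> f = (?z \<boxplus> ?z) \<cdot> f" using assms A by (subst pls_cmp) auto
  also have "\<dots> = ?z \<cdot> f \<boxplus> zer C (src C f) B" using assms A by simp
  finally show ?thesis using assms A by (subst (asm) pls_cancel_left) simp_all
qed

lemma neg_cmp:
  assumes "f \<in> arr C" "g \<in> arr C" "src C g = tgt C f"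
  shows "neg C g \<cdot> f = neg C (g \<cdot> f)"
  using assms pls_cmp[of f g "neg C g"] by (intro neg_unique) simp_all

lemma cmp_neg:
  assumes "f \<in> arr C" "g \<in> arr C" "src C g = tgt C f"
  shows "g \<cdot> neg C f = neg C (g \<cdot> f)"
  using assms cmp_pls[of f "neg C f" g] by (intro neg_unique) simp_all

end

section \<open>Kernels, cokernels and pushouts\<close>

context preadditive_category
begin

text \<open>Unique existence is split into a factorization and cancellation on the right. The
  quantifier over objects disappears because membership in \<open>Hom\<close> already forces both
  ends to be objects.\<close>

lemma is_cokernelI:
  assumes "c \<in> Hom C B Q" "f \<in> Hom C A B" "c \<cdot> f = zer C A Q"
    and "\<And>X t. t \<in> Hom C B X \<Longrightarrow> t \<cdot> f = zer C A X \<Longrightarrow> \<exists>s \<in> Hom C Q X. s \<cdot> c = t"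
    and "\<And>X s s'. s \<in> Hom C Q X \<Longrightarrow> s' \<in> Hom C Q X \<Longrightarrow> s \<cdot> c = s' \<cdot> c \<Longrightarrow> s = s'"
  shows "is_cokernel C c f"
proof -
  have "src C c = B" "tgt C c = Q" "src C f = A" "tgt C f = B" "c \<in> arr C" "f \<in> arr C"
    using assms by (auto simp: Hom_iff)
  thus ?thesis
    unfolding is_cokernel_def using assms(3,4,5) by simp metis
qed

lemma is_cokernelD:
  assumes "is_cokernel C c f"
  shows "c \<in> arr C" "f \<in> arr C" "src C c = tgt C f" "c \<cdot> f = zer C (src C f) (tgt C c)"
  using assms by (auto simp: is_cokernel_def)

lemma cokernel_factor:
  assumes "is_cokernel C c f" "t \<in> Hom C (tgt C f) X" "t \<cdot> f = zer C (src C f) X"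
  obtains s where "s \<in> Hom C (tgt C c) X" "s \<cdot> c = t"
  using assms Hom_obj[OF assms(2)] unfolding is_cokernel_def by metis

lemma cokernel_epi:
  assumes c: "is_cokernel C c f" and s: "s \<in> Hom C (tgt C c) X" "s' \<in> Hom C (tgt C c) X"
    and eq: "s \<cdot> c = s' \<cdot> c"
  shows "s = s'"
proof -
  note [simp] = is_cokernelD[OF c]
  have "s' \<cdot> c \<in> Hom C (tgt C f) X" "(s' \<cdot> c) \<cdot> f = zer C (src C f) X"
    using s by (auto simp: Hom_iff)
  thus ?thesis
    using c s eq Hom_obj[OF s(1)] unfolding is_cokernel_def by metis
qed

lemma is_kernelI:
  assumes "k \<in> Hom C N A" "f \<in> Hom C A B" "f \<cdot> k = zer C N B"
    and "\<And>X t. t \<in> Hom C X A \<Longrightarrow> f \<cdot> t = zer C X B \<Longrightarrow> \<exists>s \<in> Hom C X N. k \<cdot> s = t"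
    and "\<And>X s s'. s \<in> Hom C X N \<Longrightarrow> s' \<in> Hom C X N \<Longrightarrow> k \<cdot> s = k \<cdot> s' \<Longrightarrow> s = s'"
  shows "is_kernel C k f"
proof -
  have "src C k = N" "tgt C k = A" "src C f = A" "tgt C f = B" "k \<in> arr C" "f \<in> arr C"
    using assms by (auto simp: Hom_iff)
  thus ?thesis
    unfolding is_kernel_def using assms(3,4,5) by simp metis
qed

lemma is_kernelD:
  assumes "is_kernel C k f"
  shows "k \<in> arr C" "f \<in> arr C" "src C f = tgt C k" "f \<cdot> k = zer C (src C k) (tgt C f)"
  using assms by (auto simp: is_kernel_def)

lemma kernel_factor:
  assumes "is_kernel C k f" "t \<in> Hom C X (tgt C k)" "f \<cdot> t = zer C X (tgt C f)"
  obtains s where "s \<in> Hom C X (src C k)" "k \<cdot> s = t"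
  using assms Hom_obj[OF assms(2)] unfolding is_kernel_def by metis

lemma kernel_mono:
  assumes k: "is_kernel C k f" and s: "s \<in> Hom C X (src C k)" "s' \<in> Hom C X (src C k)"
    and eq: "k \<cdot> s = k \<cdot> s'"
  shows "s = s'"
proof -
  note [simp] = is_kernelD[OF k]
  have "f \<cdot> (k \<cdot> s') = (f \<cdot> k) \<cdot> s'"
    using s by (auto simp: Hom_iff simp del: is_kernelD(4)[OF k])
  hence "k \<cdot> s' \<in> Hom C X (tgt C k)" "f \<cdot> (k \<cdot> s') = zer C X (tgt C f)"
    using s by (auto simp: Hom_iff)
  thus ?thesis
    using k s eq Hom_obj[OF s(1)] unfolding is_kernel_def by metis
qed

lemma is_pushoutI:
  assumes "i \<in> Hom C A B" "f \<in> Hom C A A'" "i' \<in> Hom C A' P" "f' \<in> Hom C B P"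
    and "i' \<cdot> f = f' \<cdot> i"
    and "\<And>X u v. u \<in> Hom C A' X \<Longrightarrow> v \<in> Hom C B X \<Longrightarrow> u \<cdot> f = v \<cdot> i \<Longrightarrow>
           \<exists>s \<in> Hom C P X. s \<cdot> i' = u \<and> s \<cdot> f' = v"
    and "\<And>X s s'. s \<in> Hom C P X \<Longrightarrow> s' \<in> Hom C P X \<Longrightarrow> s \<cdot> i' = s' \<cdot> i' \<Longrightarrow>
           s \<cdot> f' = s' \<cdot> f' \<Longrightarrow> s = s'"
  shows "is_pushout C i f i' f'"
proof -
  have "src C i = A" "tgt C i = B" "src C f = A" "tgt C f = A'" "src C i' = A'" "tgt C i' = P"
    "src C f' = B" "tgt C f' = P" "i \<in> arr C" "f \<in> arr C" "i' \<in> arr C" "f' \<in> arr C"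
    using assms by (auto simp: Hom_iff)
  thus ?thesis
    unfolding is_pushout_def using assms(5-7) by simp metis
qed

lemma is_pushoutD:
  assumes "is_pushout C i f i' f'"
  shows "i \<in> arr C" "f \<in> arr C" "i' \<in> arr C" "f' \<in> arr C" "src C f = src C i"
    "src C i' = tgt C f" "src C f' = tgt C i" "tgt C f' = tgt C i'" "i' \<cdot> f = f' \<cdot> i"
  using assms by (auto simp: is_pushout_def)

lemma pushout_factor:
  assumes "is_pushout C i f i' f'" "u \<in> Hom C (tgt C f) X" "v \<in> Hom C (tgt C i) X"
    "u \<cdot> f = v \<cdot> i"
  obtains s where "s \<in> Hom C (tgt C i') X" "s \<cdot> i' = u" "s \<cdot> f' = v"
  using assms Hom_obj[OF assms(2)] unfolding is_pushout_def by metis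

lemma pushout_epi:
  assumes po: "is_pushout C i f i' f'"
    and s: "s \<in> Hom C (tgt C i') X" "s' \<in> Hom C (tgt C i') X"
    and eq: "s \<cdot> i' = s' \<cdot> i'" "s \<cdot> f' = s' \<cdot> f'"
  shows "s = s'"
proof -
  note [simp] = is_pushoutD(1-8)[OF po]
  have "s' \<cdot> i' \<in> Hom C (tgt C f) X" "s' \<cdot> f' \<in> Hom C (tgt C i) X"
    "(s' \<cdot> i') \<cdot> f = (s' \<cdot> f') \<cdot> i"
    using s is_pushoutD(9)[OF po] by (auto simp: Hom_iff)
  thus ?thesis
    using po s eq Hom_obj[OF s(1)] unfolding is_pushout_def by metis
qed

text \<open>The compatible pair of zero and \<open>p\<close> induces \<open>q\<close>. If
  \<open>t\<close> kills \<open>k\<close>, then \<open>t \<cdot> l\<close> kills \<open>i\<close>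
  and factors through \<open>p\<close>; the same factor works for \<open>q\<close>, because arrows
  out of the pushout are determined by their composites with \<open>k\<close> and
  \<open>l\<close>.\<close>

lemma pushout_cokernel:
  assumes po: "is_pushout C i g k l" and p: "is_cokernel C p i"
  obtains q where "is_cokernel C q k" "q \<cdot> l = p" "tgt C q = tgt C p"
proof -
  note [simp] = is_pushoutD(1-8)[OF po] is_cokernelD[OF p]
  have "zer C (tgt C g) (tgt C p) \<in> Hom C (tgt C g) (tgt C p)" "p \<in> Hom C (tgt C i) (tgt C p)"
    "zer C (tgt C g) (tgt C p) \<cdot> g = p \<cdot> i"
    by (auto simp: Hom_iff)
  then obtain q where q: "q \<in> Hom C (tgt C k) (tgt C p)"
    "q \<cdot> k = zer C (tgt C g) (tgt C p)" "q \<cdot> l = p"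
    using pushout_factor[OF po] by metis
  have [simp]: "q \<in> arr C" "src C q = tgt C k" "tgt C q = tgt C p" using q by (auto simp: Hom_iff)
  have "is_cokernel C q k"
  proof (rule is_cokernelI[OF q(1) _ q(2)])
    show "k \<in> Hom C (tgt C g) (tgt C k)" by (simp add: Hom_iff)
  next
    fix X t assume t: "t \<in> Hom C (tgt C k) X" "t \<cdot> k = zer C (tgt C g) X"
    hence [simp]: "t \<in> arr C" "src C t = tgt C k" "tgt C t = X" "X \<in> obj C"
      using Hom_obj by (auto simp: Hom_iff)
    have "(t \<cdot> l) \<cdot> i = (t \<cdot> k) \<cdot> g" using is_pushoutD(9)[OF po] by simp
    also have "\<dots> = zer C (src C i) X" unfolding t(2) by simp
    finally have tli: "(t \<cdot> l) \<cdot> i = zer C (src C i) X" .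
    have tl: "t \<cdot> l \<in> Hom C (tgt C i) X" by (simp add: Hom_iff)
    obtain s where s: "s \<in> Hom C (tgt C p) X" "s \<cdot> p = t \<cdot> l"
      by (rule cokernel_factor[OF p tl tli])
    note [simp] = s(1)[unfolded Hom_iff]
    have "s \<cdot> q = t"
      by (rule pushout_epi[OF po, of _ X]) (simp_all add: Hom_iff t(2) q s(2))
    thus "\<exists>s \<in> Hom C (tgt C p) X. s \<cdot> q = t" using s by blast
  next
    fix X s s' assume s: "s \<in> Hom C (tgt C p) X" "s' \<in> Hom C (tgt C p) X" "s \<cdot> q = s' \<cdot> q"
    have "s \<cdot> p = (s \<cdot> q) \<cdot> l" "s' \<cdot> p = (s' \<cdot> q) \<cdot> l"
      using s(1,2) q(3) by (auto simp: Hom_iff)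
    thus "s = s'" using cokernel_epi[OF p s(1,2)] s(3) by simp
  qed
  thus thesis using that q(3) by simp
qed

text \<open>If \<open>s\<close> factors an arrow through \<open>c\<close>, then
  \<open>neg C s\<close> factors it through \<open>neg C c\<close>. Such signs come from the cone
  differential and from translated complexes.\<close>

lemma cokernel_neg:
  assumes c: "is_cokernel C c f"
  shows "is_cokernel C (neg C c) f"
proof (rule is_cokernelI)
  note [simp] = is_cokernelD[OF c]
  show "neg C c \<in> Hom C (tgt C f) (tgt C c)" "f \<in> Hom C (src C f) (tgt C f)"
    by (simp_all add: Hom_iff)
  show "neg C c \<cdot> f = zer C (src C f) (tgt C c)" by (simp add: neg_cmp)
next
  note [simp] = is_cokernelD[OF c]
  fix X t assume t: "t \<in> Hom C (tgt C f) X" "t \<cdot> f = zer C (src C f) X"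
  then obtain s where "s \<in> Hom C (tgt C c) X" "s \<cdot> c = t" using cokernel_factor[OF c] by metis
  hence "neg C s \<in> Hom C (tgt C c) X" "neg C s \<cdot> neg C c = t"
    by (auto simp: Hom_iff neg_cmp cmp_neg)
  thus "\<exists>s \<in> Hom C (tgt C c) X. s \<cdot> neg C c = t" by blast
next
  note [simp] = is_cokernelD[OF c]
  fix X s s'
  assume s: "s \<in> Hom C (tgt C c) X" "s' \<in> Hom C (tgt C c) X" "s \<cdot> neg C c = s' \<cdot> neg C c"
  hence "neg C (neg C (s \<cdot> c)) = neg C (neg C (s' \<cdot> c))" by (auto simp: Hom_iff cmp_neg)
  thus "s = s'" using cokernel_epi[OF c s(1,2)] s(1,2) by (auto simp: Hom_iff)
qed

end

section \<open>Biproducts\<close>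

context additive_category
begin

lemma is_biproduct_biprod:
  assumes "A \<in> obj C" "B \<in> obj C"
  shows "is_biproduct C A B (bsum C A B, in1 C A B, in2 C A B, pr1 C A B, pr2 C A B)"
proof -
  have "is_biproduct C A B (biprod C A B)"
    unfolding biprod_def using ex_biproduct[OF assms] by (rule someI_ex)
  thus ?thesis
    by (cases "biprod C A B") (simp add: bsum_def in1_def in2_def pr1_def pr2_def)
qed

lemma biprod_simps [simp]:
  assumes "A \<in> obj C" "B \<in> obj C"
  shows "bsum C A B \<in> obj C"
    "in1 C A B \<in> arr C" "src C (in1 C A B) = A" "tgt C (in1 C A B) = bsum C A B"
    "in2 C A B \<in> arr C" "src C (in2 C A B) = B" "tgt C (in2 C A B) = bsum C A B"
    "pr1 C A B \<in> arr C" "src C (pr1 C A B) = bsum C A B" "tgt C (pr1 C A B) = A"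
    "pr2 C A B \<in> arr C" "src C (pr2 C A B) = bsum C A B" "tgt C (pr2 C A B) = B"
    "pr1 C A B \<cdot> in1 C A B = idn C A" "pr2 C A B \<cdot> in2 C A B = idn C B"
    "pr2 C A B \<cdot> in1 C A B = zer C A B" "pr1 C A B \<cdot> in2 C A B = zer C B A"
  using is_biproduct_biprod[OF assms] src_tgt_obj[of "pr1 C A B"]
  by (auto simp: is_biproduct_def Hom_iff)

lemma biprod_idn:
  assumes "A \<in> obj C" "B \<in> obj C"
  shows "in1 C A B \<cdot> pr1 C A B \<boxplus> in2 C A B \<cdot> pr2 C A B = idn C (bsum C A B)"
  using is_biproduct_biprod[OF assms] by (auto simp: is_biproduct_def)

lemma pr_in_cmp [simp]:
  assumes "A \<in> obj C" "B \<in> obj C" "x \<in> arr C"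
  shows "tgt C x = A \<Longrightarrow> pr1 C A B \<cdot> (in1 C A B \<cdot> x) = x"
    "tgt C x = A \<Longrightarrow> pr2 C A B \<cdot> (in1 C A B \<cdot> x) = zer C (src C x) B"
    "tgt C x = B \<Longrightarrow> pr1 C A B \<cdot> (in2 C A B \<cdot> x) = zer C (src C x) A"
    "tgt C x = B \<Longrightarrow> pr2 C A B \<cdot> (in2 C A B \<cdot> x) = x"
  using assms by (simp_all flip: cmp_assoc')

text \<open>Composing with the decomposition of the identity of the biproduct expresses every arrow
  through its two restrictions.\<close>

lemma biprod_ext:
  assumes "A \<in> obj C" "B \<in> obj C" "f \<in> Hom C (bsum C A B) X" "g \<in> Hom C (bsum C A B) X"
    and eq: "f \<cdot> in1 C A B = g \<cdot> in1 C A B" "f \<cdot> in2 C A B = g \<cdot> in2 C A B"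
  shows "f = g"
proof -
  have *: "h = (h \<cdot> in1 C A B) \<cdot> pr1 C A B \<boxplus> (h \<cdot> in2 C A B) \<cdot> pr2 C A B"
    if "h \<in> Hom C (bsum C A B) X" for h
  proof -
    have "h = h \<cdot> (in1 C A B \<cdot> pr1 C A B \<boxplus> in2 C A B \<cdot> pr2 C A B)"
      using that assms(1,2) by (simp add: biprod_idn Hom_iff)
    thus ?thesis using that assms(1,2) by (auto simp: cmp_pls Hom_iff)
  qed
  show ?thesis using *[OF assms(3)] *[OF assms(4)] eq by simp
qed

end

section \<open>Inflations in the mapping cone\<close>

context right_exact_category
begin

lemma inflation_in_arr [simp]: "i \<in> \<I> \<Longrightarrow> i \<in> arr C"
  using inflation_arr by blast

text \<open>Let \<open>i\<close> be a kernel of \<open>f\<close>. Since \<open>f\<close> kills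
  \<open>i\<close>, it factors as \<open>m \<cdot> c\<close>; so whatever \<open>c\<close> kills is
  killed by \<open>f\<close> and lifts through \<open>i\<close>.\<close>

lemma inflation_is_kernel_of_cokernel:
  assumes "i \<in> \<I>" and c: "is_cokernel C c i"
  shows "is_kernel C i c"
proof -
  obtain f where f: "is_kernel C i f" using inflation_kernel assms(1) by blast
  note [simp] = is_kernelD(1-3)[OF f] is_cokernelD[OF c]
  have "f \<in> Hom C (tgt C i) (tgt C f)" by (simp add: Hom_iff)
  then obtain m where m: "m \<in> Hom C (tgt C c) (tgt C f)" "m \<cdot> c = f"
    using cokernel_factor[OF c] is_kernelD(4)[OF f] by metis
  show ?thesis
  proof (rule is_kernelI)
    fix X t assume t: "t \<in> Hom C X (tgt C i)" "c \<cdot> t = zer C X (tgt C c)"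
    note [simp] = m(1)[unfolded Hom_iff] t(1)[unfolded Hom_iff] Hom_obj[OF t(1)]
    have "f \<cdot> t = (m \<cdot> c) \<cdot> t" by (simp only: m(2))
    also have "\<dots> = m \<cdot> (c \<cdot> t)" by simp
    also have "\<dots> = zer C X (tgt C f)" unfolding t(2) by simp
    finally show "\<exists>s \<in> Hom C X (src C i). i \<cdot> s = t" using kernel_factor[OF f t(1)] by metis
  qed (use kernel_mono[OF f] in \<open>auto simp: Hom_iff\<close>)
qed

lemma inflation_mono:
  assumes "i \<in> \<I>" "s \<in> Hom C X (src C i)" "s' \<in> Hom C X (src C i)" "i \<cdot> s = i \<cdot> s'"
  shows "s = s'"
  using inflation_kernel[OF assms(1)] kernel_mono assms(2-4) by blast

text \<open>The arrow is \<open>i \<oplus> 1\<close>. Together with the two injections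
  \<open>in1\<close> it completes a pushout square on \<open>i\<close>, so
  \<open>R2_inflation\<close> applies.\<close>

lemma inflation_sum_idn:
  assumes i: "i \<in> \<I>" "i \<in> Hom C A A'" and B: "B \<in> obj C"
  shows "in1 C A' B \<cdot> (i \<cdot> pr1 C A B) \<boxplus> in2 C A' B \<cdot> pr2 C A B \<in> \<I>"
proof -
  have [simp]: "i \<in> arr C" "src C i = A" "tgt C i = A'" "A \<in> obj C" "A' \<in> obj C" "B \<in> obj C"
    using i B Hom_obj[OF i(2)] by (auto simp: Hom_iff)
  let ?e = "in1 C A' B \<cdot> (i \<cdot> pr1 C A B) \<boxplus> in2 C A' B \<cdot> pr2 C A B"
  have "is_pushout C i (in1 C A B) ?e (in1 C A' B)"
  proof (rule is_pushoutI[OF i(2)])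
    show "in1 C A B \<in> Hom C A (bsum C A B)" "?e \<in> Hom C (bsum C A B) (bsum C A' B)"
      "in1 C A' B \<in> Hom C A' (bsum C A' B)" by (auto simp: Hom_iff)
    show "?e \<cdot> in1 C A B = in1 C A' B \<cdot> i" by (simp add: pls_cmp)
  next
    fix X u v assume u: "u \<in> Hom C (bsum C A B) X" and v: "v \<in> Hom C A' X"
      and uv: "u \<cdot> in1 C A B = v \<cdot> i"
    have [simp]: "u \<in> arr C" "src C u = bsum C A B" "tgt C u = X"
      "v \<in> arr C" "src C v = A'" "tgt C v = X" "X \<in> obj C"
      using u v Hom_obj[OF u] by (auto simp: Hom_iff)
    \<comment> \<open>The mediating arrow must be \<open>v\<close> on the first summand and must
      agree with \<open>u\<close> on the second, which \<open>?e\<close> leaves unchanged.\<close>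
    let ?s = "v \<cdot> pr1 C A' B \<boxplus> (u \<cdot> in2 C A B) \<cdot> pr2 C A' B"
    have "?s \<cdot> ?e = u"
      by (rule biprod_ext[of A B _ X]) (simp_all add: Hom_iff pls_cmp cmp_pls uv)
    moreover have "?s \<cdot> in1 C A' B = v" by (simp add: pls_cmp)
    ultimately show "\<exists>s \<in> Hom C (bsum C A' B) X. s \<cdot> ?e = u \<and> s \<cdot> in1 C A' B = v"
      by (intro bexI[of _ ?s]) (auto simp: Hom_iff)
  next
    fix X s s' assume s: "s \<in> Hom C (bsum C A' B) X" "s' \<in> Hom C (bsum C A' B) X"
      and eq: "s \<cdot> ?e = s' \<cdot> ?e" "s \<cdot> in1 C A' B = s' \<cdot> in1 C A' B"
    have "?e \<cdot> in2 C A B = in2 C A' B" by (simp add: pls_cmp)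
    hence "s \<cdot> in2 C A' B = s' \<cdot> in2 C A' B"
      using arg_cong[OF eq(1), of "\<lambda>x. x \<cdot> in2 C A B"] s by (auto simp: Hom_iff)
    thus "s = s'" using biprod_ext[OF _ _ s] eq(2) by simp
  qed
  thus ?thesis using R2_inflation i(1) by blast
qed

text \<open>The claimed inflation is a pushout of \<open>j\<close> along \<open>k\<close>, with
  \<open>in2\<close> as the other leg. The extension \<open>r\<close> of \<open>j\<close> is what
  splits the pushout into the cokernel of \<open>k\<close> and \<open>B\<close>.\<close>

lemma inflation_pair:
  assumes k: "k \<in> Hom C N P" and q: "is_cokernel C q k" and j: "j \<in> \<I>" "j \<in> Hom C N B"
    and r: "r \<in> Hom C P B" "r \<cdot> k = j"
  shows "in1 C (tgt C q) B \<cdot> q \<boxplus> in2 C (tgt C q) B \<cdot> r \<in> \<I>"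
proof -
  define Q where "Q = tgt C q"
  note [simp] = is_cokernelD[OF q]
  have [simp]: "k \<in> arr C" "src C k = N" "tgt C k = P" "j \<in> arr C" "src C j = N" "tgt C j = B"
    "r \<in> arr C" "src C r = P" "tgt C r = B" "tgt C q = Q" "B \<in> obj C" "P \<in> obj C" "N \<in> obj C"
    using k j r Hom_obj[OF k] Hom_obj[OF r(1)] by (auto simp: Hom_iff Q_def)
  have k_st: "src C k = N" "tgt C k = P" "tgt C q = Q" by simp_all
  have Q [simp]: "Q \<in> obj C" 
    using src_tgt_obj(2)[OF is_cokernelD(1)[OF q]] by simp
  let ?e = "in1 C Q B \<cdot> q \<boxplus> in2 C Q B \<cdot> r"
  have "is_pushout C j k ?e (in2 C Q B)"
  proof (rule is_pushoutI[OF j(2) k])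
    show "?e \<in> Hom C P (bsum C Q B)" "in2 C Q B \<in> Hom C B (bsum C Q B)"
      by (auto simp: Hom_iff)
    show "?e \<cdot> k = in2 C Q B \<cdot> j" by (simp add: pls_cmp r(2))
  next
    fix X u v assume u: "u \<in> Hom C P X" and v: "v \<in> Hom C B X" and uv: "u \<cdot> k = v \<cdot> j"
    have [simp]: "u \<in> arr C" "src C u = P" "tgt C u = X"
      "v \<in> arr C" "src C v = B" "tgt C v = X" "X \<in> obj C"
      using u v Hom_obj[OF u] by (auto simp: Hom_iff)
    \<comment> \<open>Correcting \<open>u\<close> by \<open>v \<cdot> r\<close> makes it vanish on
      \<open>k\<close>, since \<open>r\<close> extends \<open>j\<close> and
      \<open>u \<cdot> k = v \<cdot> j\<close>. The corrected arrow descends to \<open>w\<close> on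
      the cokernel, and the mediating arrow has components \<open>w\<close> and
      \<open>v\<close>.\<close>
    have "(u \<boxplus> neg C (v \<cdot> r)) \<cdot> k = zer C N X"
      by (simp add: pls_cmp neg_cmp r(2) uv)
    moreover have "u \<boxplus> neg C (v \<cdot> r) \<in> Hom C P X" by (simp add: Hom_iff)
    ultimately obtain w where w: "w \<in> Hom C Q X" "w \<cdot> q = u \<boxplus> neg C (v \<cdot> r)"
      using cokernel_factor[OF q, unfolded k_st] by metis
    have [simp]: "w \<in> arr C" "src C w = Q" "tgt C w = X" using w by (auto simp: Hom_iff)
    let ?s = "w \<cdot> pr1 C Q B \<boxplus> v \<cdot> pr2 C Q B"
    have "?s \<cdot> ?e = w \<cdot> q \<boxplus> v \<cdot> r" by (simp add: pls_cmp cmp_pls)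
    also have "\<dots> = u" unfolding w(2) by (simp add: pls_assoc)
    finally have "?s \<cdot> ?e = u" .
    moreover have "?s \<cdot> in2 C Q B = v" by (simp add: pls_cmp)
    ultimately show "\<exists>s \<in> Hom C (bsum C Q B) X. s \<cdot> ?e = u \<and> s \<cdot> in2 C Q B = v"
      by (intro bexI[of _ ?s]) (auto simp: Hom_iff)
  next
    fix X s s' assume s: "s \<in> Hom C (bsum C Q B) X" "s' \<in> Hom C (bsum C Q B) X"
      and eq: "s \<cdot> ?e = s' \<cdot> ?e" "s \<cdot> in2 C Q B = s' \<cdot> in2 C Q B"
    have [simp]: "s \<in> arr C" "src C s = bsum C Q B" "tgt C s = X" "X \<in> obj C"
      "s' \<in> arr C" "src C s' = bsum C Q B" "tgt C s' = X"
      using s Hom_obj[OF s(1)] by (auto simp: Hom_iff)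
    \<comment> \<open>Agreement on \<open>in2\<close> removes the terms with \<open>r\<close>; then
      \<open>q\<close> can be cancelled because cokernels are epi.\<close>
    have "(s \<cdot> in2 C Q B) \<cdot> r \<boxplus> (s \<cdot> in1 C Q B) \<cdot> q = s \<cdot> ?e"
      "(s' \<cdot> in2 C Q B) \<cdot> r \<boxplus> (s' \<cdot> in1 C Q B) \<cdot> q = s' \<cdot> ?e"
      by (simp_all add: cmp_pls pls_comm)
    hence "(s' \<cdot> in2 C Q B) \<cdot> r \<boxplus> (s \<cdot> in1 C Q B) \<cdot> q =
           (s' \<cdot> in2 C Q B) \<cdot> r \<boxplus> (s' \<cdot> in1 C Q B) \<cdot> q"
      using eq by metis
    hence "(s \<cdot> in1 C Q B) \<cdot> q = (s' \<cdot> in1 C Q B) \<cdot> q"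
      by (subst (asm) pls_cancel_left) simp_all
    hence "s \<cdot> in1 C Q B = s' \<cdot> in1 C Q B"
      by (rule cokernel_epi[OF q, of _ X, rotated 2]) (simp_all add: Hom_iff)
    thus "s = s'" using biprod_ext[OF _ _ s] eq(2) by simp
  qed
  thus ?thesis unfolding Q_def by (rule R2_inflation[OF j(1)])
qed

text \<open>
  The pushouts of the inflations \<open>i\<close> and \<open>i'\<close> along \<open>g\<close> and \<open>g'\<close> are the objects of cocycles of
  the mapping cone: the arrow \<open>e\<close> below and its cokernel are the two parts into which the
  differential of the cone decomposes.
\<close>

lemma cone_conflation:
  assumes po: "is_pushout C i g k l" and po': "is_pushout C i' g' k' l'"
    and p: "is_cokernel C p i" and pb: "is_cokernel C pb j" and infl: "i' \<in> \<I>" "j \<in> \<I>"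
    and Homs: "i \<in> Hom C ZA A" "p \<in> Hom C A ZA'" "j \<in> Hom C ZB B" "pb \<in> Hom C B ZB'"
      "g \<in> Hom C ZA ZB" "g' \<in> Hom C ZA' ZB'" "i' \<in> Hom C ZA' A'" "f \<in> Hom C A B"
    and fi: "f \<cdot> i = j \<cdot> g" and pf: "pb \<cdot> f = g' \<cdot> p"
  shows "\<exists>e \<in> \<I>. e \<in> Hom C (tgt C k) (bsum C A' B) \<and>
           e \<cdot> l = in1 C A' B \<cdot> neg C (i' \<cdot> p) \<boxplus> in2 C A' B \<cdot> f \<and> e \<cdot> k = in2 C A' B \<cdot> j \<and>
           is_cokernel C (l' \<cdot> pr1 C A' B \<boxplus> (k' \<cdot> pb) \<cdot> pr2 C A' B) e"
proof -
  define P where "P = tgt C k"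
  define P' where "P' = tgt C k'"
  note [simp] = Homs[unfolded Hom_iff] Homs[THEN Hom_obj]
  have po_Hom: "k \<in> Hom C ZB P" "l \<in> Hom C A P" "k' \<in> Hom C ZB' P'" "l' \<in> Hom C A' P'"
    using is_pushoutD[OF po] is_pushoutD[OF po'] by (simp_all add: Hom_iff P_def P'_def)
  note [simp] = po_Hom[unfolded Hom_iff] po_Hom[THEN Hom_obj]
  \<comment> \<open>Pushing out leaves the cokernel object unchanged, so \<open>q\<close> is to
    \<open>k\<close> what \<open>p\<close> is to \<open>i\<close>.\<close>
  obtain q where q: "is_cokernel C q k" "q \<cdot> l = p" "tgt C q = ZA'"
    using pushout_cokernel[OF po p] by auto
  have q_Hom: "q \<in> Hom C P ZA'" using is_cokernelD[OF q(1)] q(3) by (simp add: Hom_iff)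
  note [simp] = q_Hom[unfolded Hom_iff]
  \<comment> \<open>The square \<open>fi\<close> makes \<open>j\<close> and \<open>f\<close> a
    compatible pair, which induces \<open>r\<close> from the pushout to \<open>B\<close>.\<close>
  have "j \<in> Hom C (tgt C g) B" "f \<in> Hom C (tgt C i) B" "j \<cdot> g = f \<cdot> i"
    using fi by (simp_all add: Hom_iff)
  then obtain r where r: "r \<in> Hom C P B" "r \<cdot> k = j" "r \<cdot> l = f"
    using pushout_factor[OF po] unfolding P_def by metis
  note [simp] = r(1)[unfolded Hom_iff]
  \<comment> \<open>Test on both legs of the pushout: on \<open>k\<close> both sides vanish, and on
    \<open>l\<close> the claim is \<open>pf\<close>.\<close>
  have pbr: "pb \<cdot> r = g' \<cdot> q"
  proof (rule pushout_epi[OF po, of _ ZB'])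
    show "pb \<cdot> r \<in> Hom C (tgt C k) ZB'" "g' \<cdot> q \<in> Hom C (tgt C k) ZB'" by (simp_all add: Hom_iff)
    show "(pb \<cdot> r) \<cdot> k = (g' \<cdot> q) \<cdot> k"
      using is_cokernelD(4)[OF pb] is_cokernelD(4)[OF q(1)] by (simp add: r(2))
    show "(pb \<cdot> r) \<cdot> l = (g' \<cdot> q) \<cdot> l" by (simp add: r(3) q(2) pf)
  qed
  define e where "e = in1 C A' B \<cdot> neg C (i' \<cdot> q) \<boxplus> in2 C A' B \<cdot> r"
  define c where "c = l' \<cdot> pr1 C A' B \<boxplus> (k' \<cdot> pb) \<cdot> pr2 C A' B"
  have e_Hom: "e \<in> Hom C P (bsum C A' B)" and c_Hom: "c \<in> Hom C (bsum C A' B) P'"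
    by (simp_all add: e_def c_def Hom_iff)
  \<comment> \<open>\<open>?m\<close> is \<open>i' \<oplus> 1\<close>, and \<open>?n\<close> has
    components \<open>-q\<close> and \<open>r\<close>. Both are inflations with composite
    \<open>e\<close>, so \<open>R1\<close> applies.\<close>
  let ?m = "in1 C A' B \<cdot> (i' \<cdot> pr1 C ZA' B) \<boxplus> in2 C A' B \<cdot> pr2 C ZA' B"
  let ?n = "in1 C ZA' B \<cdot> neg C q \<boxplus> in2 C ZA' B \<cdot> r"
  have "?m \<in> \<I>" by (rule inflation_sum_idn) (use infl Homs in simp_all)
  moreover have "?n \<in> \<I>"
    using inflation_pair[OF po_Hom(1) cokernel_neg[OF q(1)] infl(2) Homs(3) r(1,2)] by simp
  ultimately have "?m \<cdot> ?n \<in> \<I>" by (intro R1) simp_all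
  moreover have "?m \<cdot> ?n = e" by (simp add: e_def pls_cmp cmp_pls cmp_neg)
  ultimately have "e \<in> \<I>" by simp
  have "is_cokernel C c e"
  proof (rule is_cokernelI[OF c_Hom e_Hom])
    have "c \<cdot> e = neg C (l' \<cdot> (i' \<cdot> q)) \<boxplus> k' \<cdot> (pb \<cdot> r)"
      by (simp add: c_def e_def pls_cmp cmp_pls cmp_neg)
    also have "l' \<cdot> (i' \<cdot> q) = (k' \<cdot> g') \<cdot> q" unfolding is_pushoutD(9)[OF po'] by simp
    finally show "c \<cdot> e = zer C P P'" by (simp add: pbr)
  next
    fix X t assume t: "t \<in> Hom C (bsum C A' B) X" "t \<cdot> e = zer C P X"
    note [simp] = t(1)[unfolded Hom_iff] Hom_obj[OF t(1)]
    \<comment> \<open>With components \<open>?t1\<close> and \<open>?t2\<close>, the vanishing of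
      \<open>t \<cdot> e\<close> says that \<open>?t2 \<cdot> r\<close> equals
      \<open>?t1 \<cdot> (i' \<cdot> q)\<close>. Composing with \<open>k\<close> shows that
      \<open>?t2\<close> kills \<open>j\<close> and so factors as \<open>s \<cdot> pb\<close>;
      cancelling \<open>q\<close> then makes \<open>s\<close> and \<open>?t1\<close> compatible for
      the second pushout.\<close>
    let ?t1 = "t \<cdot> in1 C A' B" and ?t2 = "t \<cdot> in2 C A' B"
    have te: "?t2 \<cdot> r \<boxplus> neg C (?t1 \<cdot> (i' \<cdot> q)) = zer C P X"
      unfolding t(2)[symmetric] by (simp add: e_def cmp_pls cmp_neg pls_comm)
    have "?t2 \<cdot> r = ?t1 \<cdot> (i' \<cdot> q)" by (rule eq_if_diff_zer) (use te in simp_all)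
    hence t12: "(?t1 \<cdot> i') \<cdot> q = ?t2 \<cdot> r" by simp
    have "?t2 \<cdot> j = (?t2 \<cdot> r) \<cdot> k" using r(2) by simp
    also have "\<dots> = zer C ZB X"
      unfolding t12[symmetric] using is_cokernelD(4)[OF q(1)] by simp
    finally have "?t2 \<cdot> j = zer C (src C j) X" by simp
    moreover have "?t2 \<in> Hom C (tgt C j) X" by (simp add: Hom_iff)
    ultimately obtain s where s: "s \<in> Hom C (tgt C pb) X" "s \<cdot> pb = ?t2"
      using cokernel_factor[OF pb] by metis
    note [simp] = s(1)[unfolded Hom_iff]
    have "(s \<cdot> g') \<cdot> q = (s \<cdot> pb) \<cdot> r" by (simp add: pbr)
    also have "\<dots> = (?t1 \<cdot> i') \<cdot> q" unfolding s(2) t12 ..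
    finally have "s \<cdot> g' = ?t1 \<cdot> i'"
      by (rule cokernel_epi[OF q(1), of _ X, rotated 2]) (simp_all add: Hom_iff)
    moreover have "s \<in> Hom C (tgt C g') X" "?t1 \<in> Hom C (tgt C i') X" by (simp_all add: Hom_iff)
    ultimately obtain m where m: "m \<in> Hom C P' X" "m \<cdot> k' = s" "m \<cdot> l' = ?t1"
      using pushout_factor[OF po'] unfolding P'_def by metis
    note [simp] = m(1)[unfolded Hom_iff]
    have "m \<cdot> c = t"
    proof (rule biprod_ext[of A' B _ X])
      show "(m \<cdot> c) \<cdot> in1 C A' B = t \<cdot> in1 C A' B" by (simp add: c_def pls_cmp m(3))
      have "(m \<cdot> c) \<cdot> in2 C A' B = (m \<cdot> k') \<cdot> pb" by (simp add: c_def pls_cmp)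
      thus "(m \<cdot> c) \<cdot> in2 C A' B = t \<cdot> in2 C A' B" by (simp only: m(2) s(2))
    qed (use c_Hom in \<open>simp_all add: Hom_iff\<close>)
    thus "\<exists>s \<in> Hom C P' X. s \<cdot> c = t" using m(1) by blast
  next
    fix X s s' assume s: "s \<in> Hom C P' X" "s' \<in> Hom C P' X" and eq: "s \<cdot> c = s' \<cdot> c"
    note [simp] = s[unfolded Hom_iff] Hom_obj[OF s(1)]
    \<comment> \<open>The composite with \<open>c\<close> determines both restrictions of an arrow
      out of the second pushout, the one along \<open>k'\<close> only after composition with the epi
      \<open>pb\<close>.\<close>
    have x: "x \<cdot> l' = (x \<cdot> c) \<cdot> in1 C A' B" "(x \<cdot> k') \<cdot> pb = (x \<cdot> c) \<cdot> in2 C A' B"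
      if "x \<in> Hom C P' X" for x
      using that by (simp_all add: Hom_iff c_def pls_cmp cmp_pls)
    have "s \<cdot> k' = s' \<cdot> k'"
      by (rule cokernel_epi[OF pb, of _ X]) (simp_all only: x s eq, simp_all add: Hom_iff)
    moreover have "s \<cdot> l' = s' \<cdot> l'" by (simp only: x s eq)
    ultimately show "s = s'"
      by (rule pushout_epi[OF po' s[unfolded P'_def]])
  qed
  moreover have "e \<cdot> l = in1 C A' B \<cdot> neg C (i' \<cdot> p) \<boxplus> in2 C A' B \<cdot> f"
    by (simp add: e_def pls_cmp neg_cmp q(2) r(3))
  moreover have "e \<cdot> k = in2 C A' B \<cdot> j"
    using is_cokernelD(4)[OF q(1)] by (simp add: e_def pls_cmp neg_cmp r(2))
  ultimately show ?thesis using \<open>e \<in> \<I>\<close> e_Hom unfolding c_def P_def by blast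
qed

end

section \<open>Complexes and chain maps\<close>

text \<open>The successor index is a variable \<open>m\<close> with a side condition, so that the
  vanishing of consecutive differentials applies however the index is written.\<close>

lemma (in category) is_complexD [simp]:
  assumes "is_complex C A"
  shows "cob A n \<in> obj C" "dif A n \<in> arr C" "src C (dif A n) = cob A n"
    "tgt C (dif A n) = cob A (n + 1)"
    "m = n + 1 \<Longrightarrow> dif A m \<cdot> dif A n = zer C (cob A n) (cob A (m + 1))"
  using assms by (auto simp: is_complex_def Hom_iff add.assoc)

lemma is_complex_if_chain_map [simp]:
  "is_chain_map C f \<Longrightarrow> is_complex C (cm_src f)" "is_chain_map C f \<Longrightarrow> is_complex C (cm_tgt f)"
  by (simp_all add: is_chain_map_def)

lemma is_chain_mapD [simp]:
  assumes "is_chain_map C f"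
  shows "cm f n \<in> arr C" "src C (cm f n) = cob (cm_src f) n" "tgt C (cm f n) = cob (cm_tgt f) n"
  using assms unfolding is_chain_map_def Hom_iff by blast+

lemma chain_map_commutes:
  "is_chain_map C f \<Longrightarrow>
     dif (cm_tgt f) n \<cdot>\<^bsub>C\<^esub> cm f n = cm f (n + 1) \<cdot>\<^bsub>C\<^esub> dif (cm_src f) n"
  unfolding is_chain_map_def by blast

lemma chmap_eqI:
  "cm_src f = cm_src g \<Longrightarrow> cm_tgt f = cm_tgt g \<Longrightarrow> (\<And>n. cm f n = cm g n) \<Longrightarrow> f = g"
  by (cases f; cases g) auto

lemma Ch_simps [simp]:
  "obj (Ch C) = {A. is_complex C A}" "arr (Ch C) = {f. is_chain_map C f}"
  "src (Ch C) = cm_src" "tgt (Ch C) = cm_tgt"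
  "idn (Ch C) A = Chmap A A (\<lambda>n. idn C (cob A n))"
  "g \<cdot>\<^bsub>Ch C\<^esub> f = Chmap (cm_src f) (cm_tgt g) (\<lambda>n. cm g n \<cdot>\<^bsub>C\<^esub> cm f n)"
  "f \<boxplus>\<^bsub>Ch C\<^esub> g = Chmap (cm_src f) (cm_tgt f) (\<lambda>n. cm f n \<boxplus>\<^bsub>C\<^esub> cm g n)"
  "zer (Ch C) A B = Chmap A B (\<lambda>n. zer C (cob A n) (cob B n))"
  by (simp_all add: Ch_def)

lemma Hom_Ch_iff: "f \<in> Hom (Ch C) A B \<longleftrightarrow> is_chain_map C f \<and> cm_src f = A \<and> cm_tgt f = B"
  by (auto simp: Hom_iff)

context preadditive_category
begin

lemma Ch_cmp_chain_map [simp]: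
  assumes "is_chain_map C f" "is_chain_map C g"
    and "cm_src f = A" "cm_src g = cm_tgt f" "cm_tgt g = B"
  shows "is_chain_map C (Chmap A B (\<lambda>n. cm g n \<cdot> cm f n))"
proof -
  have [simp]: "is_complex C A" "is_complex C B" "is_complex C (cm_tgt f)"
    using assms is_complex_if_chain_map by metis+
  have "dif B n \<cdot> (cm g n \<cdot> cm f n) = (cm g (n + 1) \<cdot> cm f (n + 1)) \<cdot> dif A n" for n
  proof -
    have f: "dif (cm_tgt f) n \<cdot> cm f n = cm f (n + 1) \<cdot> dif A n"
      and g: "dif B n \<cdot> cm g n = cm g (n + 1) \<cdot> dif (cm_tgt f) n"
      using assms chain_map_commutes by metis+
    have "dif B n \<cdot> (cm g n \<cdot> cm f n) = (dif B n \<cdot> cm g n) \<cdot> cm f n"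
      using assms by simp
    also have "\<dots> = cm g (n + 1) \<cdot> (dif (cm_tgt f) n \<cdot> cm f n)"
      unfolding g using assms by simp
    also have "\<dots> = (cm g (n + 1) \<cdot> cm f (n + 1)) \<cdot> dif A n"
      unfolding f using assms by simp
    finally show ?thesis .
  qed
  thus ?thesis using assms by (simp add: is_chain_map_def[of _ "Chmap _ _ _"] Hom_iff)
qed

lemma Ch_pls_chain_map [simp]:
  assumes "is_chain_map C f" "is_chain_map C g"
    "cm_src f = A" "cm_src g = A" "cm_tgt f = B" "cm_tgt g = B"
  shows "is_chain_map C (Chmap A B (\<lambda>n. cm f n \<boxplus> cm g n))"
  using assms is_complex_if_chain_map[OF assms(1)] chain_map_commutes[OF assms(1)] chain_map_commutes[OF assms(2)]
  by (simp add: is_chain_map_def[of _ "Chmap _ _ _"] Hom_iff cmp_pls pls_cmp)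

lemma Ch_neg_chain_map [simp]:
  assumes "is_chain_map C f" "cm_src f = A" "cm_tgt f = B"
  shows "is_chain_map C (Chmap A B (\<lambda>n. neg C (cm f n)))"
  using assms is_complex_if_chain_map[OF assms(1)] chain_map_commutes[OF assms(1)]
  by (simp add: is_chain_map_def[of _ "Chmap _ _ _"] Hom_iff cmp_neg neg_cmp)

lemma Ch_idn_chain_map [simp]:
  "is_complex C A \<Longrightarrow> is_chain_map C (Chmap A A (\<lambda>n. idn C (cob A n)))"
  by (simp add: is_chain_map_def[of _ "Chmap _ _ _"] Hom_iff)

lemma Ch_zer_chain_map [simp]:
  "is_complex C A \<Longrightarrow> is_complex C B \<Longrightarrow>
     is_chain_map C (Chmap A B (\<lambda>n. zer C (cob A n) (cob B n)))"
  by (simp add: is_chain_map_def[of _ "Chmap _ _ _"] Hom_iff)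

lemma comm_group_Hom_Ch:
  assumes "is_complex C A" "is_complex C B"
  shows "comm_group (Hom_group (Ch C) A B)"
proof (rule comm_groupI)
  fix f assume "f \<in> carrier (Hom_group (Ch C) A B)"
  hence f: "is_chain_map C f" "cm_src f = A" "cm_tgt f = B"
    by (auto simp: Hom_group_def Hom_Ch_iff)
  define f' where "f' = Chmap A B (\<lambda>n. neg C (cm f n))"
  have "is_chain_map C f'" using Ch_neg_chain_map[OF f(1)] f by (simp add: f'_def)
  hence "f' \<in> carrier (Hom_group (Ch C) A B)" by (simp add: Hom_group_def Hom_Ch_iff f'_def)
  moreover have "f' \<otimes>\<^bsub>Hom_group (Ch C) A B\<^esub> f = \<one>\<^bsub>Hom_group (Ch C) A B\<^esub>"
    using f assms by (simp add: Hom_group_def f'_def)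
  ultimately show "\<exists>f' \<in> carrier (Hom_group (Ch C) A B).
      f' \<otimes>\<^bsub>Hom_group (Ch C) A B\<^esub> f = \<one>\<^bsub>Hom_group (Ch C) A B\<^esub>"
    by blast
qed (use assms in \<open>auto simp: Hom_group_def Hom_Ch_iff pls_assoc intro!: chmap_eqI pls_comm\<close>)

lemma preadditive_category_Ch: "preadditive_category (Ch C)"
proof (intro preadditive_category.intro category.intro preadditive_category_axioms.intro)
  fix A B D f g assume fg: "f \<in> Hom (Ch C) A B" "g \<in> Hom (Ch C) B D"
  thus "g \<cdot>\<^bsub>Ch C\<^esub> f \<in> Hom (Ch C) A D" by (simp add: Hom_Ch_iff)
  fix E h assume h: "h \<in> Hom (Ch C) D E"
  show "(h \<cdot>\<^bsub>Ch C\<^esub> g) \<cdot>\<^bsub>Ch C\<^esub> f = h \<cdot>\<^bsub>Ch C\<^esub> (g \<cdot>\<^bsub>Ch C\<^esub> f)"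
    using fg h by (auto simp: Hom_Ch_iff)
qed (auto simp: Hom_Ch_iff pls_cmp cmp_pls comm_group_Hom_Ch intro!: chmap_eqI)

end

section \<open>The homotopy category\<close>

text \<open>On families of degree -1 this is the differential of the Hom complex from
  \<open>A\<close> to \<open>B\<close>.\<close>

definition htpy_bd ::
  "('o, 'm, 'x) cat_data_scheme \<Rightarrow> ('o, 'm) cochain \<Rightarrow> ('o, 'm) cochain \<Rightarrow> (int \<Rightarrow> 'm) \<Rightarrow> int \<Rightarrow> 'm"
  where "htpy_bd C A B h n = (dif B (n - 1) \<cdot>\<^bsub>C\<^esub> h n) \<boxplus>\<^bsub>C\<^esub> (h (n + 1) \<cdot>\<^bsub>C\<^esub> dif A n)"

definition deg_neg1 ::
  "('o, 'm, 'x) cat_data_scheme \<Rightarrow> ('o, 'm) cochain \<Rightarrow> ('o, 'm) cochain \<Rightarrow> (int \<Rightarrow> 'm) \<Rightarrow> bool"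
  where "deg_neg1 C A B h \<longleftrightarrow> (\<forall>n. h n \<in> Hom C (cob A n) (cob B (n - 1)))"

context preadditive_category
begin

lemma deg_neg1D [simp]:
  assumes "deg_neg1 C A B h"
  shows "h n \<in> arr C" "src C (h n) = cob A n" "tgt C (h n) = cob B (n - 1)"
  using assms by (auto simp: deg_neg1_def Hom_iff)

lemma htpy_bd_arr [simp]:
  assumes "deg_neg1 C A B h" "is_complex C A" "is_complex C B"
  shows "htpy_bd C A B h n \<in> arr C" "src C (htpy_bd C A B h n) = cob A n"
    "tgt C (htpy_bd C A B h n) = cob B n"
  using assms deg_neg1D[OF assms(1)] by (simp_all add: htpy_bd_def)

lemma htpy_bd_zer:
  assumes "is_complex C A" "is_complex C B"
  shows "htpy_bd C A B (\<lambda>n. zer C (cob A n) (cob B (n - 1))) n = zer C (cob A n) (cob B n)"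
  using assms by (simp add: htpy_bd_def)

lemma htpy_bd_pls:
  assumes "is_complex C A" "is_complex C B" "deg_neg1 C A B h" "deg_neg1 C A B h'"
  shows "htpy_bd C A B (\<lambda>n. h n \<boxplus> h' n) n = htpy_bd C A B h n \<boxplus> htpy_bd C A B h' n"
  using assms deg_neg1D[OF assms(3)] deg_neg1D[OF assms(4)]
  by (simp add: htpy_bd_def cmp_pls pls_cmp pls_assoc pls_left_comm)

lemma htpy_bd_neg:
  assumes "is_complex C A" "is_complex C B" "deg_neg1 C A B h"
  shows "htpy_bd C A B (\<lambda>n. neg C (h n)) n = neg C (htpy_bd C A B h n)"
  using assms deg_neg1D[OF assms(3)]
  by (simp add: htpy_bd_def cmp_neg neg_cmp neg_pls)

text \<open>The chain map \<open>f\<close> moves past the differential in the first summand, so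
  boundaries are stable under composition on the left.\<close>

lemma htpy_bd_cmp_left:
  assumes "is_chain_map C f" "is_complex C A" "deg_neg1 C A (cm_src f) h"
  shows "cm f n \<cdot> htpy_bd C A (cm_src f) h n =
         htpy_bd C A (cm_tgt f) (\<lambda>n. cm f (n - 1) \<cdot> h n) n"
proof -
  note [simp] = deg_neg1D[OF assms(3)]
  have "(dif (cm_tgt f) (n - 1) \<cdot> cm f (n - 1)) \<cdot> h n = (cm f n \<cdot> dif (cm_src f) (n - 1)) \<cdot> h n"
    using chain_map_commutes[OF assms(1), of "n - 1"] by simp
  thus ?thesis using assms by (simp add: htpy_bd_def cmp_pls)
qed

lemma htpy_bd_cmp_right:
  assumes "is_chain_map C f" "is_complex C B" "deg_neg1 C (cm_tgt f) B h"
  shows "htpy_bd C (cm_tgt f) B h n \<cdot> cm f n = htpy_bd C (cm_src f) B (\<lambda>n. h n \<cdot> cm f n) n"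
  using assms deg_neg1D[OF assms(3)] chain_map_commutes[OF assms(1), of n]
  by (simp add: htpy_bd_def pls_cmp)

lemma eq_pls_iff:
  assumes "f \<in> arr C" "g \<in> arr C" "h \<in> arr C" "src C f = src C g" "tgt C f = tgt C g"
    "src C g = src C h" "tgt C g = tgt C h"
  shows "f \<boxplus> neg C g = h \<longleftrightarrow> f = g \<boxplus> h"
proof
  assume *: "f \<boxplus> neg C g = h"
  have "g \<boxplus> h = f" unfolding *[symmetric] using assms by (simp add: pls_left_comm)
  thus "f = g \<boxplus> h" ..
next
  assume *: "f = g \<boxplus> h"
  have "g \<boxplus> h \<boxplus> neg C g = h" using assms by (simp add: pls_assoc pls_comm[of h])
  thus "f \<boxplus> neg C g = h" unfolding * .
qed

text \<open>Saying that \<open>f\<close> is \<open>g\<close> plus a boundary, in place of a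
  difference, lets homotopies be added and composed without moving signs around.\<close>

lemma homotopic_iff:
  "homotopic C f g \<longleftrightarrow> is_chain_map C f \<and> is_chain_map C g \<and>
     cm_src f = cm_src g \<and> cm_tgt f = cm_tgt g \<and>
     (\<exists>h. deg_neg1 C (cm_src g) (cm_tgt g) h \<and>
        (\<forall>n. cm f n = cm g n \<boxplus> htpy_bd C (cm_src g) (cm_tgt g) h n))"
  (is "?L \<longleftrightarrow> ?R")
proof -
  have "cm f n \<boxplus> neg C (cm g n) = htpy_bd C (cm_src g) (cm_tgt g) h n \<longleftrightarrow>
        cm f n = cm g n \<boxplus> htpy_bd C (cm_src g) (cm_tgt g) h n"
    if "is_chain_map C f" "is_chain_map C g" "cm_src f = cm_src g" "cm_tgt f = cm_tgt g"
      "deg_neg1 C (cm_src g) (cm_tgt g) h" for h n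
    using that by (intro eq_pls_iff) simp_all
  thus ?thesis
    unfolding homotopic_def deg_neg1_def htpy_bd_def by (metis (no_types, lifting))
qed

lemma homotopicI:
  assumes "is_chain_map C f" "is_chain_map C g"
    "cm_src f = A" "cm_src g = A" "cm_tgt f = B" "cm_tgt g = B"
    "deg_neg1 C A B h" "\<And>n. cm f n = cm g n \<boxplus> htpy_bd C A B h n"
  shows "homotopic C f g"
  using assms unfolding homotopic_iff by auto

lemma homotopicE:
  assumes "homotopic C f g"
  obtains h where "deg_neg1 C (cm_src g) (cm_tgt g) h"
    "\<And>n. cm f n = cm g n \<boxplus> htpy_bd C (cm_src g) (cm_tgt g) h n"
  using assms unfolding homotopic_iff by auto

lemma homotopicD:
  assumes "homotopic C f g"
  shows "is_chain_map C f" "is_chain_map C g" "cm_src f = cm_src g" "cm_tgt f = cm_tgt g"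
  using assms unfolding homotopic_iff by auto

lemma homotopic_refl:
  assumes "is_chain_map C f"
  shows "homotopic C f f"
  by (rule homotopicI[OF assms assms refl refl refl refl,
        of "\<lambda>n. zer C (cob (cm_src f) n) (cob (cm_tgt f) (n - 1))"])
     (use assms in \<open>simp_all add: deg_neg1_def Hom_iff htpy_bd_zer\<close>)

lemma homotopic_sym:
  assumes "homotopic C f g"
  shows "homotopic C g f"
proof -
  note [simp] = homotopicD[OF assms]
  obtain h where h: "deg_neg1 C (cm_src g) (cm_tgt g) h"
    "\<And>n. cm f n = cm g n \<boxplus> htpy_bd C (cm_src g) (cm_tgt g) h n"
    using homotopicE[OF assms] by blast
  note [simp] = h(1)
  show ?thesis
    by (rule homotopicI[of _ _ "cm_src g" "cm_tgt g" "\<lambda>n. neg C (h n)"])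
       (simp_all add: h(2) htpy_bd_neg pls_assoc, simp_all add: deg_neg1_def Hom_iff deg_neg1D[OF h(1)])
qed

lemma homotopic_trans:
  assumes fg: "homotopic C f g" and gh: "homotopic C g k"
  shows "homotopic C f k"
proof -
  note [simp] = homotopicD[OF fg] homotopicD[OF gh]
  obtain h where h: "deg_neg1 C (cm_src k) (cm_tgt k) h"
    "\<And>n. cm f n = cm g n \<boxplus> htpy_bd C (cm_src k) (cm_tgt k) h n"
    using homotopicE[OF fg] by auto
  obtain h' where h': "deg_neg1 C (cm_src k) (cm_tgt k) h'"
    "\<And>n. cm g n = cm k n \<boxplus> htpy_bd C (cm_src k) (cm_tgt k) h' n"
    using homotopicE[OF gh] by blast
  note [simp] = h(1) h'(1)
  show ?thesis
    by (rule homotopicI[of _ _ "cm_src k" "cm_tgt k" "\<lambda>n. h' n \<boxplus> h n"])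
       (simp_all add: h(2) h'(2) htpy_bd_pls pls_assoc,
        simp_all add: deg_neg1_def Hom_iff deg_neg1D[OF h(1)] deg_neg1D[OF h'(1)])
qed

lemma homotopic_cmp:
  assumes f: "homotopic C f f'" and g: "homotopic C g g'" and fg: "cm_src g = cm_tgt f"
  shows "homotopic C (g \<cdot>\<^bsub>Ch C\<^esub> f) (g' \<cdot>\<^bsub>Ch C\<^esub> f')"
proof -
  note [simp] = homotopicD[OF f] homotopicD[OF g]
  have fg' [simp]: "cm_src g' = cm_tgt f'" using fg by simp
  obtain h where h: "deg_neg1 C (cm_src f') (cm_tgt f') h"
    "\<And>n. cm f n = cm f' n \<boxplus> htpy_bd C (cm_src f') (cm_tgt f') h n"
    using homotopicE[OF f] by blast
  obtain k where k: "deg_neg1 C (cm_tgt f') (cm_tgt g') k"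
    "\<And>n. cm g n = cm g' n \<boxplus> htpy_bd C (cm_tgt f') (cm_tgt g') k n"
    using homotopicE[OF g] by auto
  note [simp] = h(1) k(1) deg_neg1D[OF h(1)] deg_neg1D[OF k(1)]
  \<comment> \<open>The homotopy comes from splitting \<open>g \<cdot> f - g' \<cdot> f'\<close>
    into \<open>g' \<cdot> (f - f')\<close> and \<open>(g - g') \<cdot> f\<close>.\<close>
  let ?l = "\<lambda>n. cm g' (n - 1) \<cdot> h n" and ?r = "\<lambda>n. k n \<cdot> cm f n"
  have l: "deg_neg1 C (cm_src f') (cm_tgt g') ?l" and r: "deg_neg1 C (cm_src f') (cm_tgt g') ?r"
    by (simp_all add: deg_neg1_def Hom_iff)
  show ?thesis
  proof (rule homotopicI[of _ _ "cm_src f'" "cm_tgt g'" "\<lambda>n. ?l n \<boxplus> ?r n"])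
    show "is_chain_map C (g \<cdot>\<^bsub>Ch C\<^esub> f)" "is_chain_map C (g' \<cdot>\<^bsub>Ch C\<^esub> f')"
      using Ch_cmp_chain_map[of f g] Ch_cmp_chain_map[of f' g'] by simp_all
    show "deg_neg1 C (cm_src f') (cm_tgt g') (\<lambda>n. ?l n \<boxplus> ?r n)"
      by (simp add: deg_neg1_def Hom_iff)
    fix n
    have "cm g n \<cdot> cm f n = cm g' n \<cdot> cm f n \<boxplus> htpy_bd C (cm_tgt f') (cm_tgt g') k n \<cdot> cm f n"
      unfolding k(2) by (simp add: pls_cmp)
    also have "htpy_bd C (cm_tgt f') (cm_tgt g') k n \<cdot> cm f n = htpy_bd C (cm_src f') (cm_tgt g') ?r n"
      using htpy_bd_cmp_right[of f "cm_tgt g'" k n] by simp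
    also have "cm g' n \<cdot> cm f n = cm g' n \<cdot> cm f' n \<boxplus> htpy_bd C (cm_src f') (cm_tgt g') ?l n"
      unfolding h(2) using htpy_bd_cmp_left[of g' "cm_src f'" h n] by (simp add: cmp_pls)
    finally show "cm (g \<cdot>\<^bsub>Ch C\<^esub> f) n = cm (g' \<cdot>\<^bsub>Ch C\<^esub> f') n \<boxplus>
        htpy_bd C (cm_src f') (cm_tgt g') (\<lambda>n. ?l n \<boxplus> ?r n) n"
      using l r by (simp add: htpy_bd_pls pls_assoc)
  qed simp_all
qed

lemma homotopic_pls:
  assumes f: "homotopic C f f'" and g: "homotopic C g g'"
    and fg: "cm_src f = cm_src g" "cm_tgt f = cm_tgt g"
  shows "homotopic C (f \<boxplus>\<^bsub>Ch C\<^esub> g) (f' \<boxplus>\<^bsub>Ch C\<^esub> g')"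
proof -
  note [simp] = homotopicD[OF f] homotopicD[OF g]
  have fg' [simp]: "cm_src f' = cm_src g'" "cm_tgt f' = cm_tgt g'" using fg by simp_all
  obtain h where h: "deg_neg1 C (cm_src g') (cm_tgt g') h"
    "\<And>n. cm f n = cm f' n \<boxplus> htpy_bd C (cm_src g') (cm_tgt g') h n"
    using homotopicE[OF f] by auto
  obtain k where k: "deg_neg1 C (cm_src g') (cm_tgt g') k"
    "\<And>n. cm g n = cm g' n \<boxplus> htpy_bd C (cm_src g') (cm_tgt g') k n"
    using homotopicE[OF g] by blast
  note [simp] = h(1) k(1) deg_neg1D[OF h(1)] deg_neg1D[OF k(1)]
  show ?thesis
  proof (rule homotopicI[of _ _ "cm_src g'" "cm_tgt g'" "\<lambda>n. h n \<boxplus> k n"])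
    show "is_chain_map C (f \<boxplus>\<^bsub>Ch C\<^esub> g)" "is_chain_map C (f' \<boxplus>\<^bsub>Ch C\<^esub> g')"
      using Ch_pls_chain_map[of f g] Ch_pls_chain_map[of f' g'] by simp_all
    show "deg_neg1 C (cm_src g') (cm_tgt g') (\<lambda>n. h n \<boxplus> k n)"
      by (simp add: deg_neg1_def Hom_iff)
  qed (simp_all add: h(2) k(2) htpy_bd_pls pls_assoc pls_left_comm)
qed

section \<open>Homotopy classes and the operations of \<open>K C\<close>\<close>

lemma htpy_class_eq:
  assumes "is_chain_map C f"
  shows "htpy_class C f = htpy_class C g \<longleftrightarrow> homotopic C f g"
proof
  assume "htpy_class C f = htpy_class C g"
  hence "homotopic C g f" using homotopic_refl[OF assms] unfolding htpy_class_def by blast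
  thus "homotopic C f g" by (rule homotopic_sym)
qed (auto simp: htpy_class_def intro: homotopic_sym homotopic_trans)

lemma htpy_class_eqI: "homotopic C f g \<Longrightarrow> htpy_class C f = htpy_class C g"
  using htpy_class_eq homotopicD(1) by blast

text \<open>The operations of \<open>K C\<close> are computed on the member picked by
  \<open>rep\<close>. Up to homotopy this is the given chain map, so any representative may be used
  in its place.\<close>

lemma homotopic_rep:
  assumes "is_chain_map C f"
  shows "homotopic C f (rep (htpy_class C f))"
proof -
  have "f \<in> htpy_class C f" using homotopic_refl[OF assms] by (simp add: htpy_class_def)
  hence "rep (htpy_class C f) \<in> htpy_class C f" unfolding rep_def by (rule someI)
  thus ?thesis by (simp add: htpy_class_def)
qed

lemma K_obj_arr [simp]:
  "obj (K C) = {A. is_complex C A}" "arr (K C) = htpy_class C ` {f. is_chain_map C f}"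
  "idn (K C) A = htpy_class C (idn (Ch C) A)" "zer (K C) A B = htpy_class C (zer (Ch C) A B)"
  by (simp_all add: K_def)

lemma K_simps [simp]:
  assumes "is_chain_map C f"
  shows "src (K C) (htpy_class C f) = cm_src f" "tgt (K C) (htpy_class C f) = cm_tgt f"
  using homotopicD[OF homotopic_rep[OF assms]] by (simp_all add: K_def)

lemma K_cmp:
  assumes "is_chain_map C f" "is_chain_map C g" "cm_src g = cm_tgt f"
  shows "htpy_class C g \<cdot>\<^bsub>K C\<^esub> htpy_class C f = htpy_class C (g \<cdot>\<^bsub>Ch C\<^esub> f)"
proof -
  have "homotopic C (g \<cdot>\<^bsub>Ch C\<^esub> f)
          (rep (htpy_class C g) \<cdot>\<^bsub>Ch C\<^esub> rep (htpy_class C f))"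
    using assms by (intro homotopic_cmp homotopic_rep)
  thus ?thesis
    by (simp add: K_def htpy_class_eqI del: Ch_simps)
qed

lemma K_pls:
  assumes "is_chain_map C f" "is_chain_map C g" "cm_src f = cm_src g" "cm_tgt f = cm_tgt g"
  shows "htpy_class C f \<boxplus>\<^bsub>K C\<^esub> htpy_class C g = htpy_class C (f \<boxplus>\<^bsub>Ch C\<^esub> g)"
proof -
  have "homotopic C (f \<boxplus>\<^bsub>Ch C\<^esub> g)
          (rep (htpy_class C f) \<boxplus>\<^bsub>Ch C\<^esub> rep (htpy_class C g))"
    using assms by (intro homotopic_pls homotopic_rep)
  thus ?thesis
    by (simp add: K_def htpy_class_eqI del: Ch_simps)
qed

lemma htpy_class_Hom: "f \<in> Hom (Ch C) A B \<Longrightarrow> htpy_class C f \<in> Hom (K C) A B"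
  by (auto simp: Hom_iff)

lemma Hom_KE:
  assumes "F \<in> Hom (K C) A B"
  obtains f where "f \<in> Hom (Ch C) A B" "F = htpy_class C f"
proof -
  from assms obtain f where "is_chain_map C f" "F = htpy_class C f" by (auto simp: Hom_iff)
  thus thesis using assms that by (auto simp: Hom_iff)
qed

lemma K_cmp_Hom:
  assumes "f \<in> Hom (Ch C) A B" "g \<in> Hom (Ch C) B D"
  shows "htpy_class C g \<cdot>\<^bsub>K C\<^esub> htpy_class C f = htpy_class C (g \<cdot>\<^bsub>Ch C\<^esub> f)"
  using assms by (intro K_cmp) (auto simp: Hom_Ch_iff)

lemma K_pls_Hom:
  assumes "f \<in> Hom (Ch C) A B" "g \<in> Hom (Ch C) A B"
  shows "htpy_class C f \<boxplus>\<^bsub>K C\<^esub> htpy_class C g = htpy_class C (f \<boxplus>\<^bsub>Ch C\<^esub> g)"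
  using assms by (intro K_pls) (auto simp: Hom_Ch_iff)

text \<open>\<open>htpy_class C\<close> is onto the arrows of \<open>K C\<close> and respects
  composition, sums, identities and zeros, so every law descends from \<open>Ch C\<close> through
  representatives.\<close>

lemma preadditive_category_K: "preadditive_category (K C)"
proof -
  interpret Ch: preadditive_category "Ch C" by (rule preadditive_category_Ch)
  \<comment> \<open>The operations of \<open>Ch C\<close> stay folded, so that its laws apply to
    representatives as they stand.\<close>
  note Ch_simps [simp del]
  have pls_Hom: "f \<boxplus>\<^bsub>Ch C\<^esub> g \<in> Hom (Ch C) A B"
    if "f \<in> Hom (Ch C) A B" "g \<in> Hom (Ch C) A B" for f g A B
    using that by (auto simp: Hom_iff)
  note cls = htpy_class_Hom K_cmp_Hom K_pls_Hom Ch.cmp_Hom pls_Hom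
  have group: "comm_group (Hom_group (K C) A B)" if "A \<in> obj (Ch C)" "B \<in> obj (Ch C)" for A B
  proof (rule comm_groupI)
    fix F assume "F \<in> carrier (Hom_group (K C) A B)"
    then obtain f where f: "f \<in> Hom (Ch C) A B" "F = htpy_class C f"
      by (auto simp: Hom_group_def elim: Hom_KE)
    have "neg (Ch C) f \<in> Hom (Ch C) A B" using f by (auto simp: Hom_iff)
    moreover have "neg (Ch C) f \<boxplus>\<^bsub>Ch C\<^esub> f = zer (Ch C) A B"
      using f by (auto simp: Hom_iff)
    ultimately have "htpy_class C (neg (Ch C) f) \<in> Hom (K C) A B"
      "htpy_class C (neg (Ch C) f) \<boxplus>\<^bsub>K C\<^esub> F = zer (K C) A B"
      using f by (simp_all add: cls K_pls_Hom[of _ A B])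
    thus "\<exists>G \<in> carrier (Hom_group (K C) A B). G \<otimes>\<^bsub>Hom_group (K C) A B\<^esub> F = \<one>\<^bsub>Hom_group (K C) A B\<^esub>"
      by (auto simp: Hom_group_def)
  next
    fix F G assume "F \<in> carrier (Hom_group (K C) A B)" "G \<in> carrier (Hom_group (K C) A B)"
    then obtain f g where fg: "f \<in> Hom (Ch C) A B" "F = htpy_class C f"
        "g \<in> Hom (Ch C) A B" "G = htpy_class C g"
      by (auto simp: Hom_group_def elim!: Hom_KE)
    have "f \<boxplus>\<^bsub>Ch C\<^esub> g = g \<boxplus>\<^bsub>Ch C\<^esub> f" using fg by (intro Ch.pls_comm) (auto simp: Hom_iff)
    thus "F \<otimes>\<^bsub>Hom_group (K C) A B\<^esub> G = G \<otimes>\<^bsub>Hom_group (K C) A B\<^esub> F"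
      "F \<otimes>\<^bsub>Hom_group (K C) A B\<^esub> G \<in> carrier (Hom_group (K C) A B)"
      using fg by (simp_all add: Hom_group_def cls K_pls_Hom[of _ A B])
    fix H assume "H \<in> carrier (Hom_group (K C) A B)"
    then obtain h where h: "h \<in> Hom (Ch C) A B" "H = htpy_class C h"
      by (auto simp: Hom_group_def elim!: Hom_KE)
    have "f \<boxplus>\<^bsub>Ch C\<^esub> g \<boxplus>\<^bsub>Ch C\<^esub> h = f \<boxplus>\<^bsub>Ch C\<^esub> (g \<boxplus>\<^bsub>Ch C\<^esub> h)"
      using fg h by (intro Ch.pls_assoc) (auto simp: Hom_iff)
    thus "F \<otimes>\<^bsub>Hom_group (K C) A B\<^esub> G \<otimes>\<^bsub>Hom_group (K C) A B\<^esub> H =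
          F \<otimes>\<^bsub>Hom_group (K C) A B\<^esub> (G \<otimes>\<^bsub>Hom_group (K C) A B\<^esub> H)"
      using fg h by (simp add: Hom_group_def cls K_pls_Hom[of _ A B])
  next
    have z: "zer (Ch C) A B \<in> Hom (Ch C) A B" using that by (simp add: Hom_iff)
    thus "\<one>\<^bsub>Hom_group (K C) A B\<^esub> \<in> carrier (Hom_group (K C) A B)"
      by (simp add: Hom_group_def cls)
    fix F assume "F \<in> carrier (Hom_group (K C) A B)"
    then obtain f where f: "f \<in> Hom (Ch C) A B" "F = htpy_class C f"
      by (auto simp: Hom_group_def elim: Hom_KE)
    have "zer (Ch C) A B \<boxplus>\<^bsub>Ch C\<^esub> f = f" using f by (auto simp: Hom_iff)
    thus "\<one>\<^bsub>Hom_group (K C) A B\<^esub> \<otimes>\<^bsub>Hom_group (K C) A B\<^esub> F = F"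
      using f z by (simp add: Hom_group_def K_pls_Hom[of _ A B])
  qed
  have obj: "obj (K C) = obj (Ch C)" by (simp add: Ch_simps)
  show ?thesis
  proof (intro preadditive_category.intro category.intro preadditive_category_axioms.intro)
    fix F assume F: "F \<in> arr (K C)"
    then obtain f where f: "is_chain_map C f" "F = htpy_class C f" by auto
    thus "src (K C) F \<in> obj (K C)" "tgt (K C) F \<in> obj (K C)" by simp_all
  next
    fix A assume "A \<in> obj (K C)"
    thus "idn (K C) A \<in> Hom (K C) A A" using Ch.idn_Hom by (simp add: obj cls del: K_obj_arr(1))
  next
    fix A B D F G assume "F \<in> Hom (K C) A B" "G \<in> Hom (K C) B D"
    then obtain f g where fg: "f \<in> Hom (Ch C) A B" "F = htpy_class C f"
        "g \<in> Hom (Ch C) B D" "G = htpy_class C g"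
      by (auto elim!: Hom_KE)
    thus "G \<cdot>\<^bsub>K C\<^esub> F \<in> Hom (K C) A D" by (simp add: K_cmp_Hom[of _ A B _ D] cls)
    fix E H assume "H \<in> Hom (K C) D E"
    then obtain h where h: "h \<in> Hom (Ch C) D E" "H = htpy_class C h" by (auto elim!: Hom_KE)
    show "(H \<cdot>\<^bsub>K C\<^esub> G) \<cdot>\<^bsub>K C\<^esub> F = H \<cdot>\<^bsub>K C\<^esub> (G \<cdot>\<^bsub>K C\<^esub> F)"
      using fg h Ch.cmp_assoc[OF fg(1,3) h(1)]
      by (simp add: K_cmp_Hom[of _ A B _ D] K_cmp_Hom[of _ B D _ E] K_cmp_Hom[of _ A B _ E]
          K_cmp_Hom[of _ A D _ E] Ch.cmp_Hom[of _ A B _ D] Ch.cmp_Hom[of _ B D _ E])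
  next
    fix A B F assume "F \<in> Hom (K C) A B"
    then obtain f where f: "f \<in> Hom (Ch C) A B" "F = htpy_class C f" by (auto elim!: Hom_KE)
    have "idn (Ch C) A \<in> Hom (Ch C) A A" "idn (Ch C) B \<in> Hom (Ch C) B B"
      using Ch.Hom_obj[OF f(1)] by (auto intro: Ch.idn_Hom)
    thus "F \<cdot>\<^bsub>K C\<^esub> idn (K C) A = F" "idn (K C) B \<cdot>\<^bsub>K C\<^esub> F = F"
      using f Ch.cmp_idn_left[OF f(1)] Ch.cmp_idn_right[OF f(1)]
      by (simp_all add: K_cmp_Hom[of _ A A _ B] K_cmp_Hom[of _ A B _ B])
  next
    fix A B assume "A \<in> obj (K C)" "B \<in> obj (K C)"
    thus "comm_group (Hom_group (K C) A B)" using group obj by blast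
  next
    fix A B D F G G' assume "F \<in> Hom (K C) A B" "G \<in> Hom (K C) B D" "G' \<in> Hom (K C) B D"
    then obtain f g g' where fg: "f \<in> Hom (Ch C) A B" "F = htpy_class C f"
        "g \<in> Hom (Ch C) B D" "G = htpy_class C g" "g' \<in> Hom (Ch C) B D" "G' = htpy_class C g'"
      by (auto elim!: Hom_KE)
    show "(G \<boxplus>\<^bsub>K C\<^esub> G') \<cdot>\<^bsub>K C\<^esub> F = G \<cdot>\<^bsub>K C\<^esub> F \<boxplus>\<^bsub>K C\<^esub> G' \<cdot>\<^bsub>K C\<^esub> F"
      using fg Ch.cmp_pls_left[OF fg(1,3,5)]
      by (simp add: K_cmp_Hom[of _ A B _ D] K_pls_Hom[of _ A D] K_pls_Hom[of _ B D] pls_Hom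
          Ch.cmp_Hom[of _ A B _ D])
  next
    fix A B D F F' G assume "F \<in> Hom (K C) A B" "F' \<in> Hom (K C) A B" "G \<in> Hom (K C) B D"
    then obtain f f' g where fg: "f \<in> Hom (Ch C) A B" "F = htpy_class C f"
        "f' \<in> Hom (Ch C) A B" "F' = htpy_class C f'" "g \<in> Hom (Ch C) B D" "G = htpy_class C g"
      by (auto elim!: Hom_KE)
    show "G \<cdot>\<^bsub>K C\<^esub> (F \<boxplus>\<^bsub>K C\<^esub> F') = G \<cdot>\<^bsub>K C\<^esub> F \<boxplus>\<^bsub>K C\<^esub> G \<cdot>\<^bsub>K C\<^esub> F'"
      using fg Ch.cmp_pls_right[OF fg(1,3,5)]
      by (simp add: K_cmp_Hom[of _ A B _ D] K_pls_Hom[of _ A D] K_pls_Hom[of _ A B] pls_Hom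
          Ch.cmp_Hom[of _ A B _ D])
  qed
qed

end

section \<open>Mapping cones\<close>

context preadditive_category
begin

text \<open>A degreewise inverse commutes with the differentials automatically: insert
  \<open>g \<cdot> f = 1\<close> to the left of \<open>d \<cdot> g\<close>, move \<open>d\<close>
  past \<open>f\<close>, and cancel \<open>f \<cdot> g\<close>.\<close>

lemma Ch_isomorphism:
  assumes f: "is_chain_map C f"
    and g: "\<And>n. g n \<in> Hom C (cob (cm_tgt f) n) (cob (cm_src f) n)"
    and gf: "\<And>n. g n \<cdot> cm f n = idn C (cob (cm_src f) n)"
    and fg: "\<And>n. cm f n \<cdot> g n = idn C (cob (cm_tgt f) n)"
  shows "isomorphism (Ch C) f"
proof -
  interpret Ch: preadditive_category "Ch C" by (rule preadditive_category_Ch)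
  define g' where "g' = Chmap (cm_tgt f) (cm_src f) g"
  note [simp] = f g[unfolded Hom_iff]
  have "dif (cm_src f) n \<cdot> g n = g (n + 1) \<cdot> dif (cm_tgt f) n" for n
  proof -
    have "dif (cm_src f) n \<cdot> g n = (g (n + 1) \<cdot> cm f (n + 1)) \<cdot> (dif (cm_src f) n \<cdot> g n)"
      by (simp only: gf) simp
    also have "\<dots> = g (n + 1) \<cdot> ((cm f (n + 1) \<cdot> dif (cm_src f) n) \<cdot> g n)" by simp
    also have "\<dots> = g (n + 1) \<cdot> (dif (cm_tgt f) n \<cdot> (cm f n \<cdot> g n))"
      by (simp only: flip: chain_map_commutes[OF f]) simp
    finally show ?thesis by (simp add: fg)
  qed
  hence "is_chain_map C g'" 
    by (simp add: is_chain_map_def[of _ "Chmap _ _ _"] g'_def g)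
  hence "g' \<in> Hom (Ch C) (cm_tgt f) (cm_src f)" by (simp add: Hom_Ch_iff g'_def)
  thus ?thesis
    by (intro Ch.isomorphismI[of _ "cm_src f" "cm_tgt f" g'])
       (simp_all add: Hom_Ch_iff g'_def gf fg)
qed

lemma K_isomorphism:
  assumes "isomorphism (Ch C) f"
  shows "isomorphism (K C) (htpy_class C f)"
proof -
  interpret Ch: preadditive_category "Ch C" by (rule preadditive_category_Ch)
  interpret K: preadditive_category "K C" by (rule preadditive_category_K)
  let ?A = "cm_src f" and ?B = "cm_tgt f"
  have f: "f \<in> Hom (Ch C) ?A ?B" using assms by (simp add: isomorphism_def Hom_Ch_iff)
  obtain g where g: "g \<in> Hom (Ch C) ?B ?A" "g \<cdot>\<^bsub>Ch C\<^esub> f = idn (Ch C) ?A"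
      "f \<cdot>\<^bsub>Ch C\<^esub> g = idn (Ch C) ?B"
    by (rule Ch.isomorphismE[OF assms f])
  show ?thesis
    by (rule K.isomorphismI[of _ ?A ?B "htpy_class C g"])
       (use f g in \<open>simp_all add: htpy_class_Hom K_cmp_Hom[of f ?A ?B] K_cmp_Hom[of g ?B ?A]
          del: Ch_simps\<close>)
qed

lemma dif_dif_cmp [simp]:
  assumes "is_complex C A" "m = n + 1" "x \<in> arr C" "tgt C x = cob A n"
  shows "dif A m \<cdot> (dif A n \<cdot> x) = zer C (src C x) (cob A (m + 1))"
proof -
  have "dif A m \<cdot> (dif A n \<cdot> x) = (dif A m \<cdot> dif A n) \<cdot> x"
    using assms by (simp del: is_complexD(5))
  thus ?thesis using assms by simp
qed

text \<open>Both ways around the square reduce to \<open>d \<cdot> h \<cdot> d\<close>, the other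
  terms containing \<open>d \<cdot> d\<close>. Hence subtracting a boundary turns chain maps into
  chain maps.\<close>

lemma htpy_bd_chain_map:
  assumes "is_complex C A" "is_complex C B" "deg_neg1 C A B h"
  shows "is_chain_map C (Chmap A B (htpy_bd C A B h))"
  using assms deg_neg1D[OF assms(3)]
  by (simp add: is_chain_map_def[of _ "Chmap _ _ _"] Hom_iff)
     (simp add: htpy_bd_def cmp_pls pls_cmp ac_simps)

end

text \<open>The upper right entry is fixed to zero: cone differentials, comparison maps of cones and
  the homotopies used on them all have this shape, and sums and composites preserve it.\<close>

definition ltri ::
  "('o, 'm, 'x) cat_data_scheme \<Rightarrow> 'o \<Rightarrow> 'o \<Rightarrow> 'o \<Rightarrow> 'o \<Rightarrow> 'm \<Rightarrow> 'm \<Rightarrow> 'm \<Rightarrow> 'm" where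
  "ltri C A B A' B' a c d = mat22 C A B A' B' a (zer C B A') c d"

section \<open>Calculus of lower triangular matrices between biproducts\<close>

context additive_category
begin

lemma ltri_eq:
  assumes "a \<in> Hom C A A'" "c \<in> Hom C A B'" "d \<in> Hom C B B'"
  shows "ltri C A B A' B' a c d = in1 C A' B' \<cdot> (a \<cdot> pr1 C A B) \<boxplus>
           (in2 C A' B' \<cdot> (c \<cdot> pr1 C A B) \<boxplus> in2 C A' B' \<cdot> (d \<cdot> pr2 C A B))"
  using assms assms[THEN Hom_obj] by (simp add: ltri_def mat22_def Hom_iff cmp_pls)

lemma ltri_arr [simp]:
  assumes "a \<in> arr C" "src C a = A" "tgt C a = A'" "c \<in> arr C" "src C c = A" "tgt C c = B'"
    "d \<in> arr C" "src C d = B" "tgt C d = B'"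
  shows "ltri C A B A' B' a c d \<in> arr C" "src C (ltri C A B A' B' a c d) = bsum C A B"
    "tgt C (ltri C A B A' B' a c d) = bsum C A' B'"
proof -
  have "A \<in> obj C" "B \<in> obj C" "A' \<in> obj C" "B' \<in> obj C" using assms by auto
  thus "ltri C A B A' B' a c d \<in> arr C" "src C (ltri C A B A' B' a c d) = bsum C A B"
    "tgt C (ltri C A B A' B' a c d) = bsum C A' B'"
    using assms by (simp_all add: ltri_eq Hom_iff)
qed

lemma ltri_cmp:
  assumes "a \<in> arr C" "src C a = A" "tgt C a = A'" "c \<in> arr C" "src C c = A" "tgt C c = B'"
    "d \<in> arr C" "src C d = B" "tgt C d = B'"
    "a' \<in> arr C" "src C a' = A'" "tgt C a' = A''" "c' \<in> arr C" "src C c' = A'" "tgt C c' = B''"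
    "d' \<in> arr C" "src C d' = B'" "tgt C d' = B''"
  shows "ltri C A' B' A'' B'' a' c' d' \<cdot> ltri C A B A' B' a c d =
         ltri C A B A'' B'' (a' \<cdot> a) (c' \<cdot> a \<boxplus> d' \<cdot> c) (d' \<cdot> d)"
proof -
  have "A \<in> obj C" "B \<in> obj C" "A' \<in> obj C" "B' \<in> obj C" "A'' \<in> obj C" "B'' \<in> obj C"
    using assms by auto
  thus ?thesis using assms by (simp add: ltri_eq Hom_iff pls_cmp cmp_pls pls_assoc)
qed

lemma ltri_pls:
  assumes "a \<in> arr C" "src C a = A" "tgt C a = A'" "c \<in> arr C" "src C c = A" "tgt C c = B'"
    "d \<in> arr C" "src C d = B" "tgt C d = B'"
    "a' \<in> arr C" "src C a' = A" "tgt C a' = A'" "c' \<in> arr C" "src C c' = A" "tgt C c' = B'"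
    "d' \<in> arr C" "src C d' = B" "tgt C d' = B'"
  shows "ltri C A B A' B' a c d \<boxplus> ltri C A B A' B' a' c' d' =
         ltri C A B A' B' (a \<boxplus> a') (c \<boxplus> c') (d \<boxplus> d')"
proof -
  have "A \<in> obj C" "B \<in> obj C" "A' \<in> obj C" "B' \<in> obj C" using assms by auto
  thus ?thesis
    using assms by (simp add: ltri_eq Hom_iff pls_cmp cmp_pls pls_assoc pls_left_comm)
qed

lemma ltri_idn:
  assumes "A \<in> obj C" "B \<in> obj C"
  shows "ltri C A B A B (idn C A) (zer C A B) (idn C B) = idn C (bsum C A B)"
  using assms by (simp add: ltri_eq Hom_iff biprod_idn)

lemma ltri_zer:
  assumes "A \<in> obj C" "B \<in> obj C" "A' \<in> obj C" "B' \<in> obj C"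
  shows "ltri C A B A' B' (zer C A A') (zer C A B') (zer C B B') = zer C (bsum C A B) (bsum C A' B')"
  using assms by (simp add: ltri_eq Hom_iff)

lemma ltri_unipotent_inverse:
  assumes "A \<in> obj C" "B \<in> obj C" "c \<in> Hom C A B"
  shows "ltri C A B A B (idn C A) (neg C c) (idn C B) \<cdot> ltri C A B A B (idn C A) c (idn C B) =
           idn C (bsum C A B)"
    "ltri C A B A B (idn C A) c (idn C B) \<cdot> ltri C A B A B (idn C A) (neg C c) (idn C B) =
           idn C (bsum C A B)"
  using assms by (simp_all add: ltri_cmp Hom_iff ltri_idn)

section \<open>Cone differentials and comparison maps between cones\<close>

lemma cob_cone [simp]:
  "cob (cone C f) n = bsum C (cob (cm_src f) (n + 1)) (cob (cm_tgt f) n)"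
  by (simp add: cone_def Let_def)

lemma dif_cone:
  "dif (cone C f) n =
     ltri C (cob (cm_src f) (n + 1)) (cob (cm_tgt f) n) (cob (cm_src f) (n + 2)) (cob (cm_tgt f) (n + 1))
       (neg C (dif (cm_src f) (n + 1))) (cm f (n + 1)) (dif (cm_tgt f) n)"
  by (simp add: cone_def Let_def ltri_def)

lemma is_complex_cone [simp]:
  assumes f: "is_chain_map C f"
  shows "is_complex C (cone C f)"
  unfolding is_complex_def
proof
  fix n
  let ?A = "cm_src f" and ?B = "cm_tgt f"
  note [simp] = f
  \<comment> \<open>The diagonal entries vanish because \<open>A\<close> and \<open>B\<close> are
    complexes. The corner is \<open>d_B \<cdot> f - f \<cdot> d_A\<close>, which vanishes because
    \<open>f\<close> is a chain map.\<close>
  have "dif (cone C f) (n + 1) \<cdot> dif (cone C f) n =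
        zer C (cob (cone C f) n) (cob (cone C f) (n + 2))"
    using chain_map_commutes[OF f, of "n + 1"]
    by (simp add: dif_cone ltri_cmp cmp_neg neg_cmp ltri_zer ac_simps)
  thus "cob (cone C f) n \<in> obj C \<and>
      dif (cone C f) n \<in> Hom C (cob (cone C f) n) (cob (cone C f) (n + 1)) \<and>
      dif (cone C f) (n + 1) \<cdot> dif (cone C f) n = zer C (cob (cone C f) n) (cob (cone C f) (n + 2))"
    by (simp add: Hom_iff dif_cone ac_simps)
qed

text \<open>The standard map of cones for a square that commutes only up to homotopy: the homotopy
  \<open>h\<close> fills the corner, in degree \<open>n + 1\<close> because the source of
  \<open>u\<close> enters its cone shifted.\<close>

definition cone_map where
  "cone_map u f a h b = Chmap (cone C u) (cone C f)
     (\<lambda>n. ltri C (cob (cm_src u) (n + 1)) (cob (cm_tgt u) n) (cob (cm_src f) (n + 1)) (cob (cm_tgt f) n)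
            (cm a (n + 1)) (h (n + 1)) (cm b n))"

text \<open>The diagonal entries commute with the differentials because \<open>a\<close> and
  \<open>b\<close> are chain maps; the corner entry of the commutation is the homotopy equation
  \<open>eq\<close> in degree \<open>n + 1\<close>.\<close>

lemma cone_map_Hom:
  assumes u: "is_chain_map C u" and f: "is_chain_map C f"
    and a: "a \<in> Hom (Ch C) (cm_src u) (cm_src f)" and b: "b \<in> Hom (Ch C) (cm_tgt u) (cm_tgt f)"
    and h: "deg_neg1 C (cm_src u) (cm_tgt f) h"
    and eq: "\<And>n. cm b n \<cdot> cm u n = cm f n \<cdot> cm a n \<boxplus> htpy_bd C (cm_src u) (cm_tgt f) h n"
  shows "cone_map u f a h b \<in> Hom (Ch C) (cone C u) (cone C f)"
proof -
  note [simp] = u f a[unfolded Hom_Ch_iff] b[unfolded Hom_Ch_iff] deg_neg1D[OF h]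
  have "dif (cone C f) n \<cdot> cm (cone_map u f a h b) n =
        cm (cone_map u f a h b) (n + 1) \<cdot> dif (cone C u) n" for n
  proof -
    have comm: "dif (cm_src f) (n + 1) \<cdot> cm a (n + 1) = cm a (n + 2) \<cdot> dif (cm_src u) (n + 1)"
      "dif (cm_tgt f) n \<cdot> cm b n = cm b (n + 1) \<cdot> dif (cm_tgt u) n"
      using chain_map_commutes[of C a "n + 1"] chain_map_commutes[of C b n]
      by (simp_all add: ac_simps)
    show ?thesis
      using eq[of "n + 1"] comm
      by (simp add: dif_cone cone_map_def ltri_cmp cmp_neg neg_cmp htpy_bd_def
          ac_simps pls_assoc pls_comm pls_left_comm)
  qed
  moreover have "cm_src (cone_map u f a h b) = cone C u" "cm_tgt (cone_map u f a h b) = cone C f"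
    "cm (cone_map u f a h b) n \<in> Hom C (cob (cone C u) n) (cob (cone C f) n)" for n
    by (simp_all add: cone_map_def Hom_iff)
  ultimately show ?thesis unfolding Hom_Ch_iff is_chain_map_def by simp
qed

text \<open>
  Subtracting the boundary of \<open>diag (-s, t)\<close>, where \<open>s\<close> and \<open>t\<close> contract \<open>a - 1\<close> and \<open>b - 1\<close>,
  leaves a chain map with ones on the diagonal.
\<close>

lemma cone_endo_isomorphism:
  assumes u: "is_chain_map C u" and F: "F \<in> Hom (Ch C) (cone C u) (cone C u)"
    and F_eq: "\<And>n. cm F n =
      ltri C (cob (cm_src u) (n + 1)) (cob (cm_tgt u) n) (cob (cm_src u) (n + 1)) (cob (cm_tgt u) n)
        (cm a (n + 1)) (k n) (cm b n)"
    and k: "\<And>n. k n \<in> Hom C (cob (cm_src u) (n + 1)) (cob (cm_tgt u) n)"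
    and a: "homotopic C a (idn (Ch C) (cm_src u))" and b: "homotopic C b (idn (Ch C) (cm_tgt u))"
  shows "isomorphism (K C) (htpy_class C F)"
proof -
  let ?A = "cm_src u" and ?B = "cm_tgt u"
  obtain s where s: "deg_neg1 C ?A ?A s" "\<And>n. cm a n = idn C (cob ?A n) \<boxplus> htpy_bd C ?A ?A s n"
    by (rule homotopicE[OF a]) simp
  obtain t where t: "deg_neg1 C ?B ?B t" "\<And>n. cm b n = idn C (cob ?B n) \<boxplus> htpy_bd C ?B ?B t n"
    by (rule homotopicE[OF b]) simp
  note [simp] = u F[unfolded Hom_Ch_iff] k[unfolded Hom_iff] deg_neg1D[OF s(1)] deg_neg1D[OF t(1)]
    s(1) t(1)
  \<comment> \<open>The sign on \<open>s\<close> matches the negated differential of the shifted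
    summand, so the boundary of \<open>H\<close> has the boundaries of \<open>s\<close> and
    \<open>t\<close> on its diagonal.\<close>
  define H where "H = (\<lambda>n. ltri C (cob ?A (n + 1)) (cob ?B n) (cob ?A n) (cob ?B (n - 1))
    (neg C (s (n + 1))) (zer C (cob ?A (n + 1)) (cob ?B (n - 1))) (t n))"
  \<comment> \<open>\<open>r\<close> is the corner of the boundary of \<open>H\<close>; it need not
    vanish, as \<open>s\<close> and \<open>t\<close> need not be compatible with
    \<open>u\<close>.\<close>
  define r where "r = (\<lambda>n. neg C (cm u n \<cdot> s (n + 1)) \<boxplus> t (n + 1) \<cdot> cm u (n + 1))"
  define c where "c = (\<lambda>n. k n \<boxplus> neg C (r n))"
  define G where "G = Chmap (cone C u) (cone C u) (\<lambda>n.
    ltri C (cob ?A (n + 1)) (cob ?B n) (cob ?A (n + 1)) (cob ?B n)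
      (idn C (cob ?A (n + 1))) (c n) (idn C (cob ?B n)))"
  have r: "r n \<in> arr C" "src C (r n) = cob ?A (n + 1)" "tgt C (r n) = cob ?B n" for n
    by (simp_all add: r_def)
  note [simp] = r
  have c: "c n \<in> arr C" "src C (c n) = cob ?A (n + 1)" "tgt C (c n) = cob ?B n" for n
    by (simp_all add: c_def)
  note [simp] = c
  have H: "deg_neg1 C (cone C u) (cone C u) H"
    by (simp add: deg_neg1_def H_def Hom_iff)
  note [simp] = H
  have bd: "htpy_bd C (cone C u) (cone C u) H n =
      ltri C (cob ?A (n + 1)) (cob ?B n) (cob ?A (n + 1)) (cob ?B n)
        (htpy_bd C ?A ?A s (n + 1)) (r n) (htpy_bd C ?B ?B t n)" for n
    by (simp add: htpy_bd_def H_def dif_cone ltri_cmp ltri_pls cmp_neg neg_cmp r_def ac_simps)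
  have FG: "cm F n = cm G n \<boxplus> htpy_bd C (cone C u) (cone C u) H n" for n
    by (simp add: F_eq G_def bd ltri_pls c_def s(2) t(2) pls_assoc)
  \<comment> \<open>\<open>G\<close> is \<open>F\<close> plus the chain map \<open>N\<close>, hence
    itself a chain map.\<close>
  define N where "N = Chmap (cone C u) (cone C u) (\<lambda>n. neg C (htpy_bd C (cone C u) (cone C u) H n))"
  have N: "is_chain_map C N"
    using Ch_neg_chain_map[OF htpy_bd_chain_map[OF _ _ H]] by (simp add: N_def)
  have "G = Chmap (cone C u) (cone C u) (\<lambda>n. cm F n \<boxplus> cm N n)"
    by (rule chmap_eqI) (simp_all add: N_def FG, simp_all add: G_def pls_assoc bd)
  hence G: "is_chain_map C G"
    using Ch_pls_chain_map[OF _ N, of F "cone C u" "cone C u"] by (simp add: N_def)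
  \<comment> \<open>\<open>G\<close> is unipotent, so negating its corner inverts it in each
    degree.\<close>
  have "isomorphism (Ch C) G"
    by (rule Ch_isomorphism[OF G, of "\<lambda>n.
          ltri C (cob ?A (n + 1)) (cob ?B n) (cob ?A (n + 1)) (cob ?B n)
            (idn C (cob ?A (n + 1))) (neg C (c n)) (idn C (cob ?B n))"])
       (simp_all add: G_def Hom_iff ltri_unipotent_inverse)
  hence "isomorphism (K C) (htpy_class C G)" by (rule K_isomorphism)
  moreover have "homotopic C F G"
    by (rule homotopicI[OF _ G _ _ _ _ H FG]) (simp_all add: G_def)
  ultimately show ?thesis by (simp add: htpy_class_eqI)
qed

text \<open>The composite is lower triangular with diagonal \<open>a' \<cdot> a\<close> and
  \<open>b' \<cdot> b\<close>, both homotopic to identities, and with corner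
  \<open>h' \<cdot> a + b' \<cdot> h\<close>; \<open>cone_endo_isomorphism\<close> covers such
  endomorphisms.\<close>

lemma cone_map_composite_isomorphism:
  assumes u: "is_chain_map C u" and f: "is_chain_map C f"
    and X: "cone_map u f a h b \<in> Hom (Ch C) (cone C u) (cone C f)"
    and Y: "cone_map f u a' h' b' \<in> Hom (Ch C) (cone C f) (cone C u)"
    and a: "a \<in> Hom (Ch C) (cm_src u) (cm_src f)" and b: "b \<in> Hom (Ch C) (cm_tgt u) (cm_tgt f)"
    and a': "a' \<in> Hom (Ch C) (cm_src f) (cm_src u)" and b': "b' \<in> Hom (Ch C) (cm_tgt f) (cm_tgt u)"
    and h: "deg_neg1 C (cm_src u) (cm_tgt f) h" and h': "deg_neg1 C (cm_src f) (cm_tgt u) h'"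
    and aa: "homotopic C (a' \<cdot>\<^bsub>Ch C\<^esub> a) (idn (Ch C) (cm_src u))"
    and bb: "homotopic C (b' \<cdot>\<^bsub>Ch C\<^esub> b) (idn (Ch C) (cm_tgt u))"
  shows "isomorphism (K C)
    (htpy_class C (cone_map f u a' h' b') \<cdot>\<^bsub>K C\<^esub> htpy_class C (cone_map u f a h b))"
proof -
  interpret Ch: preadditive_category "Ch C" by (rule preadditive_category_Ch)
  note [simp] = u f a[unfolded Hom_Ch_iff] b[unfolded Hom_Ch_iff] a'[unfolded Hom_Ch_iff]
    b'[unfolded Hom_Ch_iff] deg_neg1D[OF h] deg_neg1D[OF h']
  have "isomorphism (K C)
      (htpy_class C (cone_map f u a' h' b' \<cdot>\<^bsub>Ch C\<^esub> cone_map u f a h b))"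
    by (rule cone_endo_isomorphism[OF u Ch.cmp_Hom[OF X Y] _ _ aa bb,
          of "\<lambda>n. h' (n + 1) \<cdot> cm a (n + 1) \<boxplus> cm b' n \<cdot> h (n + 1)"])
       (simp_all add: cone_map_def ltri_cmp Hom_iff)
  thus ?thesis by (simp only: K_cmp_Hom[OF X Y])
qed

text \<open>Representatives of \<alpha>, \<beta> and their inverses, with homotopies filling both
  squares, give cone maps in the two directions. These need not be inverse to each other in
  \<open>K C\<close>, but both composites are isomorphisms, and that suffices.\<close>

lemma K_isomorphic_cone:
  assumes u: "is_chain_map C u" and f: "is_chain_map C f"
    and \<alpha>: "\<alpha> \<in> Hom (K C) (cm_src u) (cm_src f)" "isomorphism (K C) \<alpha>"
    and \<beta>: "\<beta> \<in> Hom (K C) (cm_tgt u) (cm_tgt f)" "isomorphism (K C) \<beta>"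
    and comm: "\<beta> \<cdot>\<^bsub>K C\<^esub> htpy_class C u = htpy_class C f \<cdot>\<^bsub>K C\<^esub> \<alpha>"
  shows "isomorphic (K C) (cone C u) (cone C f)"
proof -
  interpret Ch: preadditive_category "Ch C" by (rule preadditive_category_Ch)
  interpret K: preadditive_category "K C" by (rule preadditive_category_K)
  let ?A = "cm_src u" and ?B = "cm_tgt u" and ?A' = "cm_src f" and ?B' = "cm_tgt f"
  have uH: "u \<in> Hom (Ch C) ?A ?B" and fH: "f \<in> Hom (Ch C) ?A' ?B'"
    using u f by (simp_all add: Hom_Ch_iff)
  note uK = htpy_class_Hom[OF uH] and fK = htpy_class_Hom[OF fH]
  obtain \<alpha>' where \<alpha>': "\<alpha>' \<in> Hom (K C) ?A' ?A" "\<alpha>' \<cdot>\<^bsub>K C\<^esub> \<alpha> = idn (K C) ?A"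
      "\<alpha> \<cdot>\<^bsub>K C\<^esub> \<alpha>' = idn (K C) ?A'"
    by (rule K.isomorphismE[OF \<alpha>(2,1)])
  obtain \<beta>' where \<beta>': "\<beta>' \<in> Hom (K C) ?B' ?B" "\<beta>' \<cdot>\<^bsub>K C\<^esub> \<beta> = idn (K C) ?B"
      "\<beta> \<cdot>\<^bsub>K C\<^esub> \<beta>' = idn (K C) ?B'"
    by (rule K.isomorphismE[OF \<beta>(2,1)])
  \<comment> \<open>The inverses form a commuting square in the opposite direction: insert
    \<open>\<alpha> \<cdot> \<alpha>'\<close>, use \<open>comm\<close>, and cancel
    \<open>\<beta>' \<cdot> \<beta>\<close>.\<close>
  have "\<beta>' \<cdot>\<^bsub>K C\<^esub> htpy_class C f =
        \<beta>' \<cdot>\<^bsub>K C\<^esub> ((htpy_class C f \<cdot>\<^bsub>K C\<^esub> \<alpha>) \<cdot>\<^bsub>K C\<^esub> \<alpha>')"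
    using K.cmp_assoc[OF \<alpha>'(1) \<alpha>(1) fK] \<alpha>'(3) K.cmp_idn_right[OF fK] by simp
  also have "\<dots> = \<beta>' \<cdot>\<^bsub>K C\<^esub> (\<beta> \<cdot>\<^bsub>K C\<^esub> (htpy_class C u \<cdot>\<^bsub>K C\<^esub> \<alpha>'))"
    using K.cmp_assoc[OF \<alpha>'(1) uK \<beta>(1)] by (simp add: comm)
  also have "\<dots> = (\<beta>' \<cdot>\<^bsub>K C\<^esub> \<beta>) \<cdot>\<^bsub>K C\<^esub> (htpy_class C u \<cdot>\<^bsub>K C\<^esub> \<alpha>')"
    using K.cmp_assoc[OF K.cmp_Hom[OF \<alpha>'(1) uK] \<beta>(1) \<beta>'(1)] by simp
  also have "\<dots> = htpy_class C u \<cdot>\<^bsub>K C\<^esub> \<alpha>'"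
    unfolding \<beta>'(2) by (rule K.cmp_idn_left[OF K.cmp_Hom[OF \<alpha>'(1) uK]])
  finally have comm': "\<beta>' \<cdot>\<^bsub>K C\<^esub> htpy_class C f = htpy_class C u \<cdot>\<^bsub>K C\<^esub> \<alpha>'" .
  obtain a where a: "a \<in> Hom (Ch C) ?A ?A'" "\<alpha> = htpy_class C a" by (rule Hom_KE[OF \<alpha>(1)])
  obtain b where b: "b \<in> Hom (Ch C) ?B ?B'" "\<beta> = htpy_class C b" by (rule Hom_KE[OF \<beta>(1)])
  obtain a' where a': "a' \<in> Hom (Ch C) ?A' ?A" "\<alpha>' = htpy_class C a'" by (rule Hom_KE[OF \<alpha>'(1)])
  obtain b' where b': "b' \<in> Hom (Ch C) ?B' ?B" "\<beta>' = htpy_class C b'" by (rule Hom_KE[OF \<beta>'(1)])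
  have htpy: "homotopic C x y" if "htpy_class C x = htpy_class C y" "x \<in> Hom (Ch C) D E" for x y D E
    using that htpy_class_eq by (auto simp: Hom_Ch_iff)
  have aa: "homotopic C (a' \<cdot>\<^bsub>Ch C\<^esub> a) (idn (Ch C) ?A)"
    "homotopic C (a \<cdot>\<^bsub>Ch C\<^esub> a') (idn (Ch C) ?A')"
    using \<alpha>'(2,3) unfolding a(2) a'(2) K_cmp_Hom[OF a(1) a'(1)] K_cmp_Hom[OF a'(1) a(1)] K_obj_arr
    using htpy[OF _ Ch.cmp_Hom[OF a(1) a'(1)]] htpy[OF _ Ch.cmp_Hom[OF a'(1) a(1)]] by blast+
  have bb: "homotopic C (b' \<cdot>\<^bsub>Ch C\<^esub> b) (idn (Ch C) ?B)"
    "homotopic C (b \<cdot>\<^bsub>Ch C\<^esub> b') (idn (Ch C) ?B')"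
    using \<beta>'(2,3) unfolding b(2) b'(2) K_cmp_Hom[OF b(1) b'(1)] K_cmp_Hom[OF b'(1) b(1)] K_obj_arr
    using htpy[OF _ Ch.cmp_Hom[OF b(1) b'(1)]] htpy[OF _ Ch.cmp_Hom[OF b'(1) b(1)]] by blast+
  have "homotopic C (b \<cdot>\<^bsub>Ch C\<^esub> u) (f \<cdot>\<^bsub>Ch C\<^esub> a)"
    using comm unfolding a(2) b(2) K_cmp_Hom[OF uH b(1)] K_cmp_Hom[OF a(1) fH]
    by (rule htpy[OF _ Ch.cmp_Hom[OF uH b(1)]])
  then obtain h where h: "deg_neg1 C ?A ?B' h"
    "\<And>n. cm b n \<cdot> cm u n = cm f n \<cdot> cm a n \<boxplus> htpy_bd C ?A ?B' h n"
    by (rule homotopicE) (use a(1) in \<open>simp add: Hom_Ch_iff\<close>)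
  have "homotopic C (b' \<cdot>\<^bsub>Ch C\<^esub> f) (u \<cdot>\<^bsub>Ch C\<^esub> a')"
    using comm' unfolding a'(2) b'(2) K_cmp_Hom[OF fH b'(1)] K_cmp_Hom[OF a'(1) uH]
    by (rule htpy[OF _ Ch.cmp_Hom[OF fH b'(1)]])
  then obtain h' where h': "deg_neg1 C ?A' ?B h'"
    "\<And>n. cm b' n \<cdot> cm f n = cm u n \<cdot> cm a' n \<boxplus> htpy_bd C ?A' ?B h' n"
    by (rule homotopicE) (use a'(1) in \<open>simp add: Hom_Ch_iff\<close>)
  note X = cone_map_Hom[OF u f a(1) b(1) h] and Y = cone_map_Hom[OF f u a'(1) b'(1) h']
  have "isomorphism (K C) (htpy_class C (cone_map u f a h b))"
    by (rule K.isomorphism_if_both_composites[OF htpy_class_Hom[OF X] htpy_class_Hom[OF Y]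
          cone_map_composite_isomorphism[OF u f X Y a(1) b(1) a'(1) b'(1) h(1) h'(1) aa(1) bb(1)]
          cone_map_composite_isomorphism[OF f u Y X a'(1) b'(1) a(1) b(1) h'(1) h(1) aa(2) bb(2)]])
  thus ?thesis unfolding isomorphic_def using htpy_class_Hom[OF X] by blast
qed

end

section \<open>Acyclic complexes\<close>

context preadditive_category
begin

text \<open>A cokernel \<open>p\<close> is epi, so an arrow kills \<open>i \<cdot> p\<close> exactly
  if it kills \<open>i\<close>. This exchanges cokernels of differentials for cokernels of
  inflations.\<close>

lemma is_cokernel_cmp_epi:
  assumes i: "i \<in> arr C" "src C i = tgt C p" and p: "is_cokernel C p x"
  shows "is_cokernel C c (i \<cdot> p) \<longleftrightarrow> is_cokernel C c i"
proof -
  note [simp] = i is_cokernelD(1-3)[OF p]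
  have zer_iff: "t \<cdot> (i \<cdot> p) = zer C (src C p) X \<longleftrightarrow> t \<cdot> i = zer C (tgt C p) X"
    if t: "t \<in> Hom C (tgt C i) X" for t X
  proof
    note [simp] = t[unfolded Hom_iff] Hom_obj[OF t]
    assume "t \<cdot> (i \<cdot> p) = zer C (src C p) X"
    hence "(t \<cdot> i) \<cdot> p = zer C (tgt C p) X \<cdot> p" by simp
    thus "t \<cdot> i = zer C (tgt C p) X"
      by (rule cokernel_epi[OF p, of _ X, rotated 2]) (simp_all add: Hom_iff)
  next
    note [simp] = t[unfolded Hom_iff] Hom_obj[OF t]
    assume *: "t \<cdot> i = zer C (tgt C p) X"
    have "t \<cdot> (i \<cdot> p) = (t \<cdot> i) \<cdot> p" by simp
    thus "t \<cdot> (i \<cdot> p) = zer C (src C p) X" unfolding * by simp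
  qed
  \<comment> \<open>Once the target of \<open>k\<close> is fixed, being a cokernel of
    \<open>k\<close> depends on \<open>k\<close> only through the arrows that kill it.\<close>
  have *: "is_cokernel C c k \<longleftrightarrow> c \<in> Hom C (tgt C i) (tgt C c) \<and> c \<cdot> k = zer C (src C k) (tgt C c) \<and>
      (\<forall>X\<in>obj C. \<forall>t \<in> Hom C (tgt C i) X. t \<cdot> k = zer C (src C k) X \<longrightarrow>
        (\<exists>!s. s \<in> Hom C (tgt C c) X \<and> s \<cdot> c = t))"
    if "k \<in> arr C" "tgt C k = tgt C i" for k
    using that(1) unfolding is_cokernel_def Hom_iff[of c] that(2) by blast
  have ip: "i \<cdot> p \<in> arr C" "tgt C (i \<cdot> p) = tgt C i" "src C (i \<cdot> p) = src C p"
    by simp_all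
  show ?thesis
    unfolding *[OF ip(1,2)] *[OF i(1) refl] ip(3) i(2) using zer_iff by blast
qed

end

context right_exact_category
begin

text \<open>Acyclicity as a splicing of conflations from \<open>Z n\<close> through
  \<open>cob A n\<close> to \<open>Z (n + 1)\<close>. In contrast to \<open>acyclic\<close>, the
  projection is indexed by the degree it leaves and is a cokernel of an inflation instead of a
  differential.\<close>

definition exact_factorization where
  "exact_factorization A Z i p \<longleftrightarrow> (\<forall>n. i n \<in> \<I> \<and> i n \<in> Hom C (Z n) (cob A n) \<and>
     p n \<in> Hom C (cob A n) (Z (n + 1)) \<and> is_cokernel C (p n) (i n) \<and> dif A n = i (n + 1) \<cdot> p n)"

lemma exact_factorizationD:
  assumes "exact_factorization A Z i p"
  shows "i n \<in> \<I>" "i n \<in> Hom C (Z n) (cob A n)" "p n \<in> Hom C (cob A n) (Z (n + 1))"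
    "is_cokernel C (p n) (i n)" "dif A n = i (n + 1) \<cdot> p n" "Z n \<in> obj C"
  using assms Hom_obj unfolding exact_factorization_def by blast+

text \<open>Since \<open>i (n + 1)\<close> is mono, \<open>dif A n\<close> has the same kernels as
  \<open>p n\<close>, and \<open>i n\<close> is one of them as the kernel of its own cokernel.
  Dually \<open>p (n - 2)\<close> is epi, so \<open>dif A (n - 2)\<close> has the same cokernels as
  \<open>i (n - 1)\<close>.\<close>

lemma acyclic_if_exact_factorization:
  assumes A: "is_complex C A" and fac: "exact_factorization A Z i p"
  shows "acyclic C \<I> A"
  unfolding acyclic_def
proof (intro conjI allI A)
  fix n
  note fac = exact_factorizationD[OF fac]
  note [simp] = fac(1) fac(2)[unfolded Hom_iff] fac(3)[unfolded Hom_iff] fac(6)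
  have "is_cokernel C (p (n - 1)) (dif A (n - 2))"
    using fac(4,5) is_cokernel_cmp_epi[of "i (n - 1)" "p (n - 2)" "i (n - 2)" "p (n - 1)"] by simp
  moreover have "p (n - 1) \<in> deflations C \<I>"
    unfolding deflations_def using fac(1,4) by blast
  moreover have "is_kernel C (i n) (dif A n)"
  proof (rule is_kernelI)
    have ker: "is_kernel C (i n) (p n)"
      using fac(1,4) by (rule inflation_is_kernel_of_cokernel)
    show "i n \<in> Hom C (Z n) (cob A n)" "dif A n \<in> Hom C (cob A n) (cob A (n + 1))"
      by (simp_all add: Hom_iff A)
    show "dif A n \<cdot> i n = zer C (Z n) (cob A (n + 1))"
      using is_kernelD(4)[OF ker] by (simp add: fac(5))
    fix X
    show "\<exists>s \<in> Hom C X (Z n). i n \<cdot> s = t"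
      if t: "t \<in> Hom C X (cob A n)" "dif A n \<cdot> t = zer C X (cob A (n + 1))" for t
    proof -
      note [simp] = t(1)[unfolded Hom_iff] Hom_obj[OF t(1)]
      have "i (n + 1) \<cdot> (p n \<cdot> t) = i (n + 1) \<cdot> zer C X (Z (n + 1))"
        using t(2) by (simp add: fac(5))
      hence "p n \<cdot> t = zer C X (Z (n + 1))"
        by (rule inflation_mono[OF fac(1), rotated 2]) (simp_all add: Hom_iff)
      hence "p n \<cdot> t = zer C X (tgt C (p n))" "t \<in> Hom C X (tgt C (i n))"
        by (simp_all add: Hom_iff)
      then obtain s where "s \<in> Hom C X (src C (i n))" "i n \<cdot> s = t"
        using kernel_factor[OF ker] by metis
      thus ?thesis by auto
    qed
    show "s = s'" if "s \<in> Hom C X (Z n)" "s' \<in> Hom C X (Z n)" "i n \<cdot> s = i n \<cdot> s'" for s s'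
      using that by (intro inflation_mono[OF fac(1)[of n], of s X s']) simp_all
  qed
  moreover have "tgt C (p (n - 1)) = src C (i n)" "dif A (n - 1) = i n \<cdot> p (n - 1)"
    using fac(5)[of "n - 1"] by simp_all
  ultimately show "\<exists>p i. p \<in> deflations C \<I> \<and> is_cokernel C p (dif A (n - 2)) \<and>
      i \<in> \<I> \<and> is_kernel C i (dif A n) \<and> tgt C p = src C i \<and> dif A (n - 1) = i \<cdot> p"
    using fac(1) by blast
qed

lemma acyclicE:
  assumes "acyclic C \<I> A"
  obtains Z i p where "exact_factorization A Z i p"
proof -
  have A [simp]: "is_complex C A" using assms by (simp add: acyclic_def)
  obtain p i where pi: "\<And>n. is_cokernel C (p n) (dif A (n - 2))" "\<And>n. i n \<in> \<I>"
    "\<And>n. is_kernel C (i n) (dif A n)" "\<And>n. tgt C (p n) = src C (i n)"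
    "\<And>n. dif A (n - 1) = i n \<cdot> p n"
    using assms unfolding acyclic_def by metis
  \<comment> \<open>The projection leaving degree \<open>n\<close> is the one that
    \<open>acyclic\<close> lists for \<open>n + 1\<close>, hence the offset.\<close>
  have "exact_factorization A (\<lambda>n. src C (i n)) i (\<lambda>n. p (n + 1))"
    unfolding exact_factorization_def
  proof (intro allI conjI)
    fix n
    show "i n \<in> \<I>" by (rule pi)
    show "i n \<in> Hom C (src C (i n)) (cob A n)"
      using is_kernelD(1,3)[OF pi(3)[of n]] by (simp add: Hom_iff)
    show "p (n + 1) \<in> Hom C (cob A n) (src C (i (n + 1)))"
      using is_cokernelD(1,3)[OF pi(1)[of "n + 1"]] pi(4)[of "n + 1"] by (simp add: Hom_iff)
    show dif: "dif A n = i (n + 1) \<cdot> p (n + 1)" using pi(5)[of "n + 1"] by simp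
    have "is_cokernel C (p (n + 1)) (i n \<cdot> p n)"
      using pi(1)[of "n + 1"] pi(5)[of n] by simp
    thus "is_cokernel C (p (n + 1)) (i n)"
      using is_cokernel_cmp_epi[OF _ _ pi(1)] pi(2,4) by simp
  qed
  thus thesis by (rule that)
qed

text \<open>The chain map induces arrows between cocycles, and \<open>cone_conflation\<close> then
  supplies a conflation in each degree; what remains is that splicing these returns the differential
  of the cone.\<close>

lemma acyclic_cone:
  assumes f: "is_chain_map C f" and "acyclic C \<I> (cm_src f)" "acyclic C \<I> (cm_tgt f)"
  shows "acyclic C \<I> (cone C f)"
proof -
  let ?A = "cm_src f" and ?B = "cm_tgt f"
  obtain ZA i p where A: "exact_factorization ?A ZA i p" using assms acyclicE by blast
  obtain ZB j q where B: "exact_factorization ?B ZB j q" using assms acyclicE by blast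
  note A = exact_factorizationD[OF A] and B = exact_factorizationD[OF B]
  note [simp] = f A(1) A(2)[unfolded Hom_iff] A(3)[unfolded Hom_iff] A(6)
    B(1) B(2)[unfolded Hom_iff] B(3)[unfolded Hom_iff] B(6)
  have comm: "j (n + 1) \<cdot> (q n \<cdot> cm f n) = cm f (n + 1) \<cdot> (i (n + 1) \<cdot> p n)" for n
    using chain_map_commutes[OF f, of n] by (simp add: A(5) B(5))
  \<comment> \<open>\<open>j n\<close> is a kernel of \<open>q n\<close>, so \<open>g n\<close>
    exists once \<open>q n\<close> kills \<open>cm f n \<cdot> i n\<close>. This may be tested after
    composing with the mono \<open>j (n + 1)\<close>, where the factor
    \<open>p n \<cdot> i n\<close> appears.\<close>
  have "\<exists>g. g \<in> Hom C (ZA n) (ZB n) \<and> j n \<cdot> g = cm f n \<cdot> i n" for n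
  proof -
    have "j (n + 1) \<cdot> (q n \<cdot> (cm f n \<cdot> i n)) = (j (n + 1) \<cdot> (q n \<cdot> cm f n)) \<cdot> i n" by simp
    also have "\<dots> = j (n + 1) \<cdot> zer C (ZA n) (ZB (n + 1))"
      unfolding comm using is_cokernelD(4)[OF A(4)[of n]] by simp
    finally have "q n \<cdot> (cm f n \<cdot> i n) = zer C (ZA n) (ZB (n + 1))"
      by (rule inflation_mono[OF B(1), rotated 2]) (simp_all add: Hom_iff)
    hence "q n \<cdot> (cm f n \<cdot> i n) = zer C (ZA n) (tgt C (q n))"
      "cm f n \<cdot> i n \<in> Hom C (ZA n) (tgt C (j n))"
      by (simp_all add: Hom_iff)
    then obtain g where "g \<in> Hom C (ZA n) (src C (j n))" "j n \<cdot> g = cm f n \<cdot> i n"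
      using kernel_factor[OF inflation_is_kernel_of_cokernel[OF B(1,4)]] by metis
    thus ?thesis by auto
  qed
  then obtain g where g: "\<And>n. g n \<in> Hom C (ZA n) (ZB n)" "\<And>n. j n \<cdot> g n = cm f n \<cdot> i n"
    by metis
  note [simp] = g(1)[unfolded Hom_iff]
  have qf: "q n \<cdot> cm f n = g (n + 1) \<cdot> p n" for n
  proof (rule inflation_mono[OF B(1)[of "n + 1"]])
    have "j (n + 1) \<cdot> (g (n + 1) \<cdot> p n) = (j (n + 1) \<cdot> g (n + 1)) \<cdot> p n" by simp
    also have "\<dots> = j (n + 1) \<cdot> (q n \<cdot> cm f n)" unfolding g(2) comm by simp
    finally show "j (n + 1) \<cdot> (q n \<cdot> cm f n) = j (n + 1) \<cdot> (g (n + 1) \<cdot> p n)" ..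
  qed (simp_all add: Hom_iff)
  have "\<exists>k l. is_pushout C (i n) (g n) k l" for n
    by (rule R2_ex) simp_all
  then obtain k l where po: "\<And>n. is_pushout C (i n) (g n) (k n) (l n)" by metis
  define P where "P = (\<lambda>n. tgt C (k n))"
  have [simp]: "k n \<in> arr C" "src C (k n) = ZB n" "tgt C (k n) = P n" "l n \<in> arr C"
    "src C (l n) = cob ?A n" "tgt C (l n) = P n" for n
    using is_pushoutD[OF po[of n]] by (simp_all add: P_def)
  define c where "c = (\<lambda>n. l (n + 1) \<cdot> pr1 C (cob ?A (n + 1)) (cob ?B n) \<boxplus>
    (k (n + 1) \<cdot> q n) \<cdot> pr2 C (cob ?A (n + 1)) (cob ?B n))"
  have "\<exists>e \<in> \<I>. e \<in> Hom C (P n) (bsum C (cob ?A (n + 1)) (cob ?B n)) \<and>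
      e \<cdot> l n = in1 C (cob ?A (n + 1)) (cob ?B n) \<cdot> neg C (i (n + 1) \<cdot> p n) \<boxplus>
                 in2 C (cob ?A (n + 1)) (cob ?B n) \<cdot> cm f n \<and>
      e \<cdot> k n = in2 C (cob ?A (n + 1)) (cob ?B n) \<cdot> j n \<and> is_cokernel C (c n) e" for n
    unfolding c_def P_def
    \<comment> \<open>The primed data of \<open>cone_conflation\<close> are taken in degree
      \<open>n + 1\<close>, the other data in degree \<open>n\<close>.\<close>
    by (rule cone_conflation[OF po po A(4) B(4) A(1) B(1) A(2,3) B(2,3) g(1) g(1) A(2)])
       (simp_all add: Hom_iff g(2) qf)
  then obtain e where e: "\<And>n. e n \<in> \<I>"
    "\<And>n. e n \<in> Hom C (P n) (bsum C (cob ?A (n + 1)) (cob ?B n))"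
    "\<And>n. e n \<cdot> l n = in1 C (cob ?A (n + 1)) (cob ?B n) \<cdot> neg C (i (n + 1) \<cdot> p n) \<boxplus>
                 in2 C (cob ?A (n + 1)) (cob ?B n) \<cdot> cm f n"
    "\<And>n. e n \<cdot> k n = in2 C (cob ?A (n + 1)) (cob ?B n) \<cdot> j n" "\<And>n. is_cokernel C (c n) (e n)"
    by metis
  note [simp] = e(2)[unfolded Hom_iff]
  \<comment> \<open>\<open>e (n + 1) \<cdot> l (n + 1)\<close> is the first column of the cone
    differential, and \<open>e (n + 1) \<cdot> k (n + 1)\<close> becomes the second after
    composition with \<open>q n\<close>.\<close>
  have "dif (cone C f) n = e (n + 1) \<cdot> c n" for n
  proof -
    let ?p1 = "pr1 C (cob ?A (n + 1)) (cob ?B n)" and ?p2 = "pr2 C (cob ?A (n + 1)) (cob ?B n)"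
    have "e (n + 1) \<cdot> c n =
          (e (n + 1) \<cdot> l (n + 1)) \<cdot> ?p1 \<boxplus> (e (n + 1) \<cdot> k (n + 1)) \<cdot> (q n \<cdot> ?p2)"
      by (simp add: c_def cmp_pls)
    also have "\<dots> = dif (cone C f) n"
      unfolding e(3,4) dif_cone
      by (subst ltri_eq) (simp_all add: Hom_iff ac_simps A(5) B(5) pls_cmp pls_assoc)
    finally show ?thesis ..
  qed
  hence "exact_factorization (cone C f) P e c"
    unfolding exact_factorization_def using e by (simp add: Hom_iff c_def)
  thus ?thesis by (rule acyclic_if_exact_factorization[OF is_complex_cone[OF f]])
qed

text \<open>The projections absorb the sign, and their negatives are still cokernels. An arbitrary
  offset \<open>k\<close> covers the shift and its inverse at once.\<close>

lemma acyclic_translate: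
  assumes "acyclic C \<I> A"
  shows "acyclic C \<I> (Cochain (\<lambda>n. cob A (n + k)) (\<lambda>n. neg C (dif A (n + k))))" (is "acyclic C \<I> ?A")
proof -
  have A [simp]: "is_complex C A" using assms by (simp add: acyclic_def)
  obtain Z i p where "exact_factorization A Z i p" using assms acyclicE by blast
  note fac = exact_factorizationD[OF this]
  note [simp] = fac(1) fac(2)[unfolded Hom_iff] fac(3)[unfolded Hom_iff] fac(6)
  have "is_complex C ?A"
    by (simp add: is_complex_def[of _ "Cochain _ _"] Hom_iff cmp_neg neg_cmp ac_simps)
  moreover have "exact_factorization ?A (\<lambda>n. Z (n + k)) (\<lambda>n. i (n + k)) (\<lambda>n. neg C (p (n + k)))"
    using fac(4,5) by (simp add: exact_factorization_def Hom_iff cokernel_neg cmp_neg ac_simps)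
  ultimately show ?thesis by (rule acyclic_if_exact_factorization)
qed

lemma shift_Ac: "shift C ` Ac C \<I> = Ac C \<I>"
proof
  show "shift C ` Ac C \<I> \<subseteq> Ac C \<I>"
    using acyclic_translate[of _ 1] by (auto simp: Ac_def shift_def)
  show "Ac C \<I> \<subseteq> shift C ` Ac C \<I>"
  proof
    fix A assume "A \<in> Ac C \<I>"
    hence A: "acyclic C \<I> A" "is_complex C A" by (simp_all add: Ac_def acyclic_def)
    \<comment> \<open>The preimage moves the indices back and negates the differential; the second
      negation, in \<open>shift\<close>, gives back \<open>A\<close> itself and not just an
      isomorphic complex.\<close>
    let ?A = "Cochain (\<lambda>n. cob A (n - 1)) (\<lambda>n. neg C (dif A (n - 1)))"
    have "A = shift C ?A" 
      using is_complexD(2)[OF A(2)] by (cases A) (simp add: shift_def)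
    moreover have "?A \<in> Ac C \<I>" using acyclic_translate[OF A(1), of "-1"] by (simp add: Ac_def)
    ultimately show "A \<in> shift C ` Ac C \<I>" by blast
  qed
qed

end

section \<open>Additivity of the category of acyclic complexes\<close>

text \<open>Every arrow into or out of \<open>Z\<close> is unchanged by composition with
  \<open>idn C Z\<close>, hence zero. As an equation between arrows, the criterion can be checked on
  chain maps and carried over to \<open>K C\<close>.\<close>

lemma (in preadditive_category) is_zero_objectI:
  assumes Z: "Z \<in> obj C" "idn C Z = zer C Z Z"
  shows "is_zero_object C Z"
proof -
  have "f = zer C X Z" if "f \<in> Hom C X Z" for f X
  proof -
    note [simp] = that[unfolded Hom_iff] Hom_obj[OF that]
    have "idn C Z \<cdot> f = zer C X Z" unfolding Z(2) by simp
    thus ?thesis by simp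
  qed
  moreover have "f = zer C Z X" if "f \<in> Hom C Z X" for f X
  proof -
    note [simp] = that[unfolded Hom_iff] Hom_obj[OF that]
    have "f \<cdot> idn C Z = zer C Z X" unfolding Z(2) by simp
    thus ?thesis by simp
  qed
  ultimately show ?thesis
    unfolding is_zero_object_def using Z(1) by (metis Hom_iff zer_arr)
qed

lemma (in preadditive_category) is_zero_objectD:
  assumes "is_zero_object C Z"
  shows "Z \<in> obj C" "idn C Z = zer C Z Z"
proof -
  show Z: "Z \<in> obj C" using assms by (simp add: is_zero_object_def)
  hence "idn C Z \<in> Hom C Z Z" "zer C Z Z \<in> Hom C Z Z" by (simp_all add: Hom_iff)
  thus "idn C Z = zer C Z Z" using assms Z unfolding is_zero_object_def by blast
qed

text \<open>Biproducts are given by equations between arrows, and \<open>htpy_class C\<close>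
  respects all the operations in them.\<close>

lemma (in preadditive_category) is_biproduct_K:
  assumes "is_biproduct (Ch C) A B (P, i1, i2, p1, p2)"
  shows "is_biproduct (K C) A B
    (P, htpy_class C i1, htpy_class C i2, htpy_class C p1, htpy_class C p2)"
proof -
  interpret Ch: preadditive_category "Ch C" by (rule preadditive_category_Ch)
  have Homs: "i1 \<in> Hom (Ch C) A P" "i2 \<in> Hom (Ch C) B P" "p1 \<in> Hom (Ch C) P A" "p2 \<in> Hom (Ch C) P B"
    and eqs: "p1 \<cdot>\<^bsub>Ch C\<^esub> i1 = idn (Ch C) A" "p2 \<cdot>\<^bsub>Ch C\<^esub> i2 = idn (Ch C) B"
      "p2 \<cdot>\<^bsub>Ch C\<^esub> i1 = zer (Ch C) A B" "p1 \<cdot>\<^bsub>Ch C\<^esub> i2 = zer (Ch C) B A"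
      "(i1 \<cdot>\<^bsub>Ch C\<^esub> p1) \<boxplus>\<^bsub>Ch C\<^esub> (i2 \<cdot>\<^bsub>Ch C\<^esub> p2) = idn (Ch C) P"
    using assms unfolding is_biproduct_def by blast+
  note cmps = K_cmp_Hom[OF Homs(1,3)] K_cmp_Hom[OF Homs(2,4)] K_cmp_Hom[OF Homs(1,4)]
    K_cmp_Hom[OF Homs(2,3)] K_cmp_Hom[OF Homs(3,1)] K_cmp_Hom[OF Homs(4,2)]
    K_pls_Hom[OF Ch.cmp_Hom[OF Homs(3,1)] Ch.cmp_Hom[OF Homs(4,2)]]
  show ?thesis
    unfolding is_biproduct_def prod.case cmps eqs K_obj_arr
    using Homs[THEN htpy_class_Hom] by blast
qed

section \<open>Full subcategories and their additivity\<close>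

lemma Hom_full_subcategory:
  "A \<in> S \<Longrightarrow> B \<in> S \<Longrightarrow> Hom (full_subcategory T S) A B = Hom T A B"
  by (auto simp: Hom_def full_subcategory_def)

lemma full_subcategory_simps [simp]:
  "obj (full_subcategory T S) = S"
  "arr (full_subcategory T S) = {f \<in> arr T. src T f \<in> S \<and> tgt T f \<in> S}"
  "src (full_subcategory T S) = src T" "tgt (full_subcategory T S) = tgt T"
  "idn (full_subcategory T S) = idn T" "cmp (full_subcategory T S) = cmp T"
  "pls (full_subcategory T S) = pls T" "zer (full_subcategory T S) = zer T"
  by (simp_all add: full_subcategory_def)

text \<open>Hom groups and composition are those of the ambient category, so only a zero object and
  biproducts inside \<open>S\<close> have to be supplied.\<close>

lemma (in preadditive_category) additive_full_subcategory:
  assumes S: "S \<subseteq> obj C" and Z: "Z \<in> S" "is_zero_object C Z"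
    and biprod: "\<And>A B. A \<in> S \<Longrightarrow> B \<in> S \<Longrightarrow>
      \<exists>P i1 i2 p1 p2. P \<in> S \<and> is_biproduct C A B (P, i1, i2, p1, p2)"
  shows "additive_category (full_subcategory C S)"
proof (intro additive_category.intro preadditive_category.intro category.intro
    preadditive_category_axioms.intro additive_category_axioms.intro)
  have Hom: "f \<in> Hom (full_subcategory C S) A B \<longleftrightarrow> f \<in> Hom C A B \<and> A \<in> S \<and> B \<in> S" for f A B
    by (auto simp: Hom_iff)
  note [simp] = Hom
  show "comm_group (Hom_group (full_subcategory C S) A B)"
    if "A \<in> obj (full_subcategory C S)" "B \<in> obj (full_subcategory C S)" for A B
    using that S Hom_comm_group[of A B] by (auto simp: Hom_group_def Hom_full_subcategory)
  show "\<exists>Z. is_zero_object (full_subcategory C S) Z"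
    using Z S by (intro exI[of _ Z]) (auto simp: is_zero_object_def subset_iff)
  show "\<exists>P. is_biproduct (full_subcategory C S) A B P"
    if "A \<in> obj (full_subcategory C S)" "B \<in> obj (full_subcategory C S)" for A B
  proof -
    have AB: "A \<in> S" "B \<in> S" using that by simp_all
    then obtain P i1 i2 p1 p2 where "P \<in> S" "is_biproduct C A B (P, i1, i2, p1, p2)"
      using biprod by blast
    hence "is_biproduct (full_subcategory C S) A B (P, i1, i2, p1, p2)"
      using AB unfolding is_biproduct_def by simp
    thus ?thesis ..
  qed
qed (use S in \<open>auto simp: Hom_full_subcategory Hom_iff pls_cmp cmp_pls\<close>)

context right_exact_category
begin

text \<open>Take a zero object in every degree, with itself as cocycles. The inflations are then its
  identity, which is the zero arrow and is supplied by \<open>R0\<close>.\<close>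

lemma ex_acyclic_zero_object: "\<exists>Z. acyclic C \<I> Z \<and> is_zero_object (K C) Z"
proof -
  interpret K: preadditive_category "K C" by (rule preadditive_category_K)
  obtain Z where Z: "is_zero_object C Z" using ex_zero_object by blast
  note [simp] = is_zero_objectD(1)[OF Z] and idn = is_zero_objectD(2)[OF Z]
  let ?Z = "Cochain (\<lambda>n. Z) (\<lambda>n. zer C Z Z)"
  have cx: "is_complex C ?Z" by (simp add: is_complex_def[of _ "Cochain _ _"] Hom_iff)
  have "is_cokernel C (zer C Z Z) (zer C Z Z)"
  proof (rule is_cokernelI)
    fix X t assume t: "t \<in> Hom C Z X"
    note [simp] = t[unfolded Hom_iff]
    have "t \<cdot> zer C Z Z = t" unfolding idn[symmetric] by simp
    thus "\<exists>s \<in> Hom C Z X. s \<cdot> zer C Z Z = t" using t by blast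
  next
    fix X s s' assume "s \<in> Hom C Z X" "s' \<in> Hom C Z X"
    thus "s = s'" using Z Hom_obj unfolding is_zero_object_def by blast
  qed (simp_all add: Hom_iff)
  hence "exact_factorization ?Z (\<lambda>n. Z) (\<lambda>n. zer C Z Z) (\<lambda>n. zer C Z Z)"
    using R0[OF Z] by (simp add: exact_factorization_def Hom_iff idn)
  hence "acyclic C \<I> ?Z" by (rule acyclic_if_exact_factorization[OF cx])
  moreover have "is_zero_object (K C) ?Z"
    by (rule K.is_zero_objectI) (use cx in \<open>simp_all add: idn\<close>)
  ultimately show ?thesis by blast
qed

text \<open>The direct sum \<open>A \<oplus> B\<close> is the mapping cone of the zero map \<open>A[-1] \<rightarrow> B\<close>.\<close>

lemma ex_acyclic_biproduct:
  assumes A: "acyclic C \<I> A" and B: "acyclic C \<I> B"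
  shows "\<exists>P i1 i2 p1 p2. acyclic C \<I> P \<and> is_biproduct (K C) A B (P, i1, i2, p1, p2)"
proof -
  have [simp]: "is_complex C A" "is_complex C B" using A B by (simp_all add: acyclic_def)
  \<comment> \<open>This is \<open>A[-1]\<close>. Its negated differential is negated again by the
    cone, which restores \<open>dif A\<close>.\<close>
  let ?A = "Cochain (\<lambda>n. cob A (n - 1)) (\<lambda>n. neg C (dif A (n - 1)))"
  have A': "acyclic C \<I> ?A" using acyclic_translate[OF A, of "-1"] by simp
  hence [simp]: "is_complex C ?A" by (simp add: acyclic_def)
  define z where "z = zer (Ch C) ?A B"
  have z: "is_chain_map C z" "cm_src z = ?A" "cm_tgt z = B"
    using Ch_zer_chain_map[of ?A B] by (simp_all add: z_def)
  let ?P = "cone C z"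
  have P: "acyclic C \<I> ?P" by (rule acyclic_cone) (simp_all add: z A' B)
  have [simp]: "is_complex C ?P" using P by (simp add: acyclic_def)
  have cob: "cob ?P n = bsum C (cob A n) (cob B n)" for n by (simp add: z)
  have dif: "dif ?P n = in1 C (cob A (n + 1)) (cob B (n + 1)) \<cdot> (dif A n \<cdot> pr1 C (cob A n) (cob B n)) \<boxplus>
      in2 C (cob A (n + 1)) (cob B (n + 1)) \<cdot> (dif B n \<cdot> pr2 C (cob A n) (cob B n))" for n
    unfolding dif_cone z by (subst ltri_eq) (simp_all add: z_def Hom_iff ac_simps)
  let ?i1 = "Chmap A ?P (\<lambda>n. in1 C (cob A n) (cob B n))"
  let ?i2 = "Chmap B ?P (\<lambda>n. in2 C (cob A n) (cob B n))"
  let ?p1 = "Chmap ?P A (\<lambda>n. pr1 C (cob A n) (cob B n))"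
  let ?p2 = "Chmap ?P B (\<lambda>n. pr2 C (cob A n) (cob B n))"
  \<comment> \<open>The cone differential is diagonal because the map is zero, so the injections and
    projections commute with it.\<close>
  have "?i1 \<in> Hom (Ch C) A ?P" "?i2 \<in> Hom (Ch C) B ?P" "?p1 \<in> Hom (Ch C) ?P A" "?p2 \<in> Hom (Ch C) ?P B"
    by (simp_all add: Hom_Ch_iff is_chain_map_def[of _ "Chmap _ _ _"] Hom_iff cob dif pls_cmp cmp_pls
        del: cob_cone)
  hence "is_biproduct (Ch C) A B (?P, ?i1, ?i2, ?p1, ?p2)"
    unfolding is_biproduct_def by (simp add: cob biprod_idn del: cob_cone)
  thus ?thesis using P is_biproduct_K by blast
qed

lemma additive_category_Ac: "additive_category (full_subcategory (K C) (Ac C \<I>))"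
proof -
  interpret K: preadditive_category "K C" by (rule preadditive_category_K)
  obtain Z where "acyclic C \<I> Z" "is_zero_object (K C) Z" using ex_acyclic_zero_object by blast
  thus ?thesis
    using ex_acyclic_biproduct
    by (intro K.additive_full_subcategory[of _ Z]) (auto simp: Ac_def acyclic_def)
qed

text \<open>The ends of the chain map \<open>f\<close> witnessing distinguishedness are only
  isomorphic in \<open>K C\<close> to acyclic complexes and need not be acyclic. A representative
  \<open>u'\<close> of \<open>u\<close> has the acyclic complexes themselves as ends, so its cone is
  acyclic; it is isomorphic to the cone of \<open>f\<close>, and thereby to the third
  vertex.\<close>

lemma Ac_third_vertex:
  assumes uvw: "(u, v, w) \<in> distinguished_triangles C"
    and acyc: "src (K C) u \<in> Ac C \<I>" "src (K C) v \<in> Ac C \<I>"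
  shows "\<exists>Z \<in> Ac C \<I>. isomorphic (K C) (src (K C) w) Z"
proof -
  interpret K: preadditive_category "K C" by (rule preadditive_category_K)
  obtain f a b c where uv: "u \<in> arr (K C)" "tgt (K C) u = src (K C) v"
    and f: "is_chain_map C f"
    and a: "a \<in> Hom (K C) (src (K C) u) (cm_src f)" "isomorphism (K C) a"
    and b: "b \<in> Hom (K C) (src (K C) v) (cm_tgt f)" "isomorphism (K C) b"
    and c: "c \<in> Hom (K C) (src (K C) w) (cone C f)" "isomorphism (K C) c"
    and comm: "b \<cdot>\<^bsub>K C\<^esub> u = htpy_class C f \<cdot>\<^bsub>K C\<^esub> a"
    using uvw unfolding distinguished_triangles_def by auto
  obtain u' where u': "is_chain_map C u'" "u = htpy_class C u'" using uv(1) by auto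
  have st: "src (K C) u = cm_src u'" "src (K C) v = cm_tgt u'"
    using u' uv(2) by simp_all
  have "isomorphic (K C) (cone C u') (cone C f)"
    by (rule K_isomorphic_cone[OF u'(1) f a[unfolded st(1)] b[unfolded st(2)] comm[unfolded u'(2)]])
  moreover have "isomorphic (K C) (src (K C) w) (cone C f)"
    unfolding isomorphic_def using c by blast
  ultimately have "isomorphic (K C) (src (K C) w) (cone C u')"
    using K.isomorphic_sym K.isomorphic_trans by blast
  moreover have "cone C u' \<in> Ac C \<I>"
    using acyclic_cone[OF u'(1)] acyc unfolding st Ac_def by simp
  ultimately show ?thesis by blast
qed

end

section \<open>The conditions on a triangulated subcategory, put together\<close>

theorem corollary7p3:
  fixes C :: "('o, 'm, 'x) cat_data_scheme" and \<I> :: "'m set"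
  assumes "right_exact_category C \<I>"
  shows "triangulated_subcategory (K C) (shift C) (distinguished_triangles C) (Ac C \<I>)"
proof -
  interpret right_exact_category C \<I> by (rule assms)
  have "Ac C \<I> \<subseteq> obj (K C)" by (auto simp: Ac_def acyclic_def)
  thus ?thesis
    unfolding triangulated_subcategory_def
    using additive_category_Ac shift_Ac Ac_third_vertex by blast
qed

end
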